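(* Let $D$ be a division ring with infinite center $F$, let $K$ be a division subring of $D$, and let $N$ be a non-central almost subnormal subgroup of the multiplicative group $D^*$ (non-central means $N\not\subseteq F$). If $K$ is $N$-invariant, then $K\subseteq F$ or $K=D$.
   Context: $D^*=D\setminus\{0\}$ is the multiplicative group of the division ring $D$. A subgroup $N$ of a group $G$ is almost subnormal in $G$ if there is a finite series of subgroups $N=N_r\leq N_{r-1}\leq\cdots\leq N_1\leq N_0=G$ such that for each $0\le i<r$, either $N_{i+1}$ is normal in $N_i$ or the index $[N_i:N_{i+1}]$ is finite. A division subring $K$ of $D$ is $N$-invariant if $xKx^{-1}=K$ for every $x\in N$. *)

theory Defs
  imports "HOL-Algebra.Coset"
begin

text \<open>The division ring \<open>D\<close> is a type of class \<^class>\<open>division_ring\<close> (not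
  necessarily commutative). Its multiplicative group \<open>D\<^sup>* = D - {0}\<close> is a group in the
  sense of HOL-Algebra, so that subgroups, normality and cosets are the library notions.\<close>

definition mult_group :: "'a::division_ring monoid" where
  "mult_group = \<lparr>carrier = UNIV - {0}, mult = (*), one = 1\<rparr>"

definition ring_center :: "'a::division_ring set" where
  "ring_center = {z. \<forall>x. z * x = x * z}"

definition finite_index :: "'g set \<Rightarrow> ('g, 'b) monoid_scheme \<Rightarrow> bool" where
  "finite_index H G \<longleftrightarrow> finite (rcosets\<^bsub>G\<^esub> H)"

definition almost_subnormal :: "'g set \<Rightarrow> ('g, 'b) monoid_scheme \<Rightarrow> bool" where
  "almost_subnormal N G \<longleftrightarrow>
    (\<exists>(r::nat) (S :: nat \<Rightarrow> 'g set).
       S 0 = carrier G \<and> S r = N \<and>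
       (\<forall>i\<le>r. subgroup (S i) G) \<and>
       (\<forall>i<r. S (Suc i) \<subseteq> S i \<and>
          (S (Suc i) \<lhd> G\<lparr>carrier := S i\<rparr> \<or> finite_index (S (Suc i)) (G\<lparr>carrier := S i\<rparr>))))"

definition division_subring :: "'a::division_ring set \<Rightarrow> bool" where
  "division_subring K \<longleftrightarrow>
    0 \<in> K \<and> 1 \<in> K \<and>
    (\<forall>x\<in>K. \<forall>y\<in>K. x - y \<in> K \<and> x * y \<in> K) \<and>
    (\<forall>x\<in>K. x \<noteq> 0 \<longrightarrow> inverse x \<in> K)"

definition invariant_under :: "'a::division_ring set \<Rightarrow> 'a set \<Rightarrow> bool" where
  "invariant_under N K \<longleftrightarrow> (\<forall>x\<in>N. (\<lambda>k. x * k * inverse x) ` K = K)"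

lemma group_mult_group: "group (mult_group :: 'a::division_ring monoid)"
proof (rule groupI)
  fix x :: 'a assume "x \<in> carrier mult_group"
  then show "\<exists>y\<in>carrier mult_group. y \<otimes>\<^bsub>mult_group\<^esub> x = \<one>\<^bsub>mult_group\<^esub>"
    by (intro bexI[of _ "inverse x"]) (auto simp: mult_group_def)
qed (auto simp: mult_group_def mult.assoc)

end

theory Submission
  imports Defs
begin

text \<open>Write \<open>F\<close> for the center of \<open>D\<close>.

  Reduction to subnormal subgroups. Replacing subgroups of finite index by their cores, one finds in
  every almost subnormal subgroup \<open>N\<close> a subgroup \<open>H\<close> that is subnormal in \<open>D\<^sup>*\<close> and has finite
  index in \<open>N\<close> (\<open>almost_sub_subnormal\<close>). Because \<open>F\<close> is infinite, an almost subnormal subgroup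
  with a central subgroup of finite index is itself central (\<open>almost_sub_central\<close>), so \<open>H\<close> is
  non-central, and it suffices to treat \<open>H\<close>
  (\<open>subnormal_invariant_division_subring\<close>).

  Subnormal subgroups. Let \<open>N\<close> be subnormal of depth \<open>r\<close> and let \<open>g \<in> N\<close>. Put
  \<open>\<sigma> x = g x g\<^sup>-\<^sup>1\<close>, \<open>\<delta> x = x - \<sigma> x\<close> and \<open>\<omega> x = x (\<sigma> x)\<^sup>-\<^sup>1\<close>, the commutator of \<open>x\<close> and \<open>g\<close>.
  Each commutator descends one step of the series, so \<open>\<omega>\<^sup>r x \<in> N\<close> for all \<open>x \<noteq> 0\<close>. For central
  \<open>t\<close> the element \<open>\<omega>\<^sup>r (1 + t y)\<close> is a rational function of \<open>t\<close> with expansion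
  \<open>1 + t \<delta>\<^sup>r y + \<dots>\<close> (\<open>om_first_order\<close>), and infinitely many values of \<open>t\<close> are available. The
  rational functions that are regular at \<open>0\<close> form a ring in which elements with nonzero value
  at \<open>0\<close> are invertible. Two properties of these functions are used: vanishing at
  infinitely many \<open>t\<close> forces vanishing at \<open>0\<close>, and if \<open>K \<inter> F\<close> is infinite, then values in \<open>K\<close> at
  all but finitely many \<open>t \<in> K \<inter> F\<close> force a value in \<open>K\<close> at \<open>0\<close> (\<open>regular_value_mem\<close>).

  A further tool works in every characteristic: if \<open>\<sigma> u = k u\<close> and \<open>\<sigma> k = k\<close>, then
  \<open>\<delta>\<^sup>n u = (1 - k)\<^sup>n u\<close>, so that \<open>\<delta>\<^sup>n u = 0 \<noteq> u\<close> implies \<open>k = 1\<close>. Hence where \<open>\<delta>\<close> is nilpotent,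
  \<open>\<omega>\<^sup>n x = 1\<close> for some \<open>n \<ge> 1\<close> already implies \<open>\<sigma> x = x\<close> (\<open>om_nilpotent\<close>).

  The case of infinite \<open>K \<inter> F\<close> and \<open>K \<noteq> D\<close>. The expansion shows that additive commutators of
  \<open>\<delta>\<^sup>r y\<close> with elements of \<open>K\<close> lie in \<open>K\<close> (\<open>lie_mem\<close>). From this, \<open>\<delta>\<close> is nilpotent on \<open>D\<close>
  whenever \<open>g \<in> N \<inter> K\<close>; comparing two such elements gives that \<open>N \<inter> K\<close> centralizes \<open>K\<close>
  (\<open>Int_commute\<close>). Similarly \<open>N\<close> centralizes the center of \<open>K\<close> (\<open>center_commute\<close>). Now
  \<open>\<omega>\<^sup>r x\<close>, for nonzero \<open>x \<in> K\<close>, lies in \<open>N \<inter> K\<close>, hence in the center of \<open>K\<close>, so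
  \<open>\<omega>\<^sup>r\<^sup>+\<^sup>1 x = 1\<close>, and the tool above yields that \<open>N\<close> centralizes \<open>K\<close>. If \<open>K\<close> is not central, the same results apply to
  the centralizer of \<open>K\<close>, which contains \<open>N\<close>; they show first that \<open>N\<close> is abelian and then that
  \<open>N\<close> is central.

  The case of finite \<open>K \<inter> F\<close>. If \<open>K\<close> is not central, then the centralizer of \<open>K\<close> contains \<open>F\<close>
  and is therefore \<open>F\<close> by the first case. A rational function with coefficients in \<open>K\<close> and values
  in \<open>K\<close> at generic \<open>t \<in> F\<close> is generically constant, since all but finitely many \<open>t\<close> satisfy no
  nontrivial polynomial equation of bounded degree over \<open>K\<close> (\<open>regular_generic_constant\<close>). Applied to conjugates by
  \<open>\<omega>\<^sup>r (a + t b)\<close> this gives \<open>\<omega>\<^sup>r x \<in> F\<close> for nonzero \<open>x \<in> K\<close>, and again \<open>N\<close> centralizes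
  \<open>K\<close>, which is absurd for non-central \<open>N\<close>.\<close>

section \<open>Conjugation\<close>

text \<open>The centralizer of a subset \<open>S\<close> in the whole division ring \<open>D\<close>, zero included.\<close>

definition centralizer :: "'a::division_ring set \<Rightarrow> 'a set" where
  "centralizer S = {x. \<forall>s\<in>S. x * s = s * x}"

text \<open>Conjugation by \<open>g\<close>, for \<open>g \<noteq> 0\<close> the automorphism \<open>\<sigma>\<close>.\<close>

definition cj :: "'a::division_ring \<Rightarrow> 'a \<Rightarrow> 'a" where
  "cj g x = g * x * inverse g"

text \<open>The operator \<open>\<delta> = 1 - \<sigma>\<close>.\<close>

definition dl :: "'a::division_ring \<Rightarrow> 'a \<Rightarrow> 'a" where
  "dl g x = x - cj g x"

text \<open>The operator \<open>\<omega>\<close>; for nonzero \<open>g\<close> and \<open>x\<close> its value is the commutator \<open>x g x\<^sup>-\<^sup>1 g\<^sup>-\<^sup>1\<close>.\<close>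

definition om :: "'a::division_ring \<Rightarrow> 'a \<Rightarrow> 'a" where
  "om g x = x * inverse (cj g x)"

lemma cj_0 [simp]: "cj g 0 = 0"
  by (simp add: cj_def)

lemma cj_1: "g \<noteq> 0 \<Longrightarrow> cj g 1 = 1"
  by (simp add: cj_def)

lemma cj_add: "cj g (x + y) = cj g x + cj g y"
  by (simp add: cj_def algebra_simps)

lemma cj_diff: "cj g (x - y) = cj g x - cj g y"
  by (simp add: cj_def algebra_simps)

lemma cj_mult:
  assumes "g \<noteq> 0"
  shows "cj g (x * y) = cj g x * cj g y"
proof -
  have "cj g x * cj g y = g * x * (inverse g * g) * y * inverse g"
    unfolding cj_def by (simp only: mult.assoc)
  then show ?thesis
    using assms by (simp add: cj_def mult.assoc del: mult_cancel_left mult_cancel_right)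
qed

lemma cj_eq_0_iff: "g \<noteq> 0 \<Longrightarrow> cj g x = 0 \<longleftrightarrow> x = 0"
  by (auto simp: cj_def)

lemma cj_inverse:
  assumes "g \<noteq> 0"
  shows "cj g (inverse x) = inverse (cj g x)"
  using assms
  by (cases "x = 0") (auto simp: cj_def nonzero_inverse_mult_distrib mult.assoc)

lemma cj_eq_iff:
  assumes "g \<noteq> 0"
  shows "cj g x = y \<longleftrightarrow> g * x = y * g"
proof
  assume "cj g x = y"
  then have "y * g = g * x * (inverse g * g)"
    unfolding cj_def by (simp only: mult.assoc [symmetric])
  then show "g * x = y * g"
    using assms by simp
next
  assume "g * x = y * g"
  then have "cj g x = y * (g * inverse g)"
    unfolding cj_def by (simp only: mult.assoc)
  then show "cj g x = y"
    using assms by simp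
qed

lemma dl_0 [simp]: "dl g 0 = 0"
  by (simp add: dl_def)

lemma dl_add: "dl g (x + y) = dl g x + dl g y"
  by (simp add: dl_def cj_add)

lemma dl_eq_0_iff:
  assumes "g \<noteq> 0"
  shows "dl g x = 0 \<longleftrightarrow> g * x = x * g"
  using cj_eq_iff [OF assms, of x x] by (auto simp: dl_def)

lemma dl_mult_right:
  assumes "g \<noteq> 0" "g * b = b * g"
  shows "(dl g ^^ n) (x * b) = (dl g ^^ n) x * b"
proof (induction n)
  case (Suc n)
  have "cj g b = b"
    using assms by (simp add: cj_eq_iff)
  then show ?case
    using Suc assms by (simp add: dl_def cj_mult algebra_simps)
qed simp

lemma dl_mult_left:
  assumes "g \<noteq> 0" "g * b = b * g"
  shows "(dl g ^^ n) (b * x) = b * (dl g ^^ n) x"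
proof (induction n)
  case (Suc n)
  have "cj g b = b"
    using assms by (simp add: cj_eq_iff)
  then show ?case
    using Suc assms by (simp add: dl_def cj_mult algebra_simps)
qed simp

lemma om_nz: "g \<noteq> 0 \<Longrightarrow> x \<noteq> 0 \<Longrightarrow> om g x \<noteq> 0"
  by (simp add: om_def cj_eq_0_iff)

lemma om_funpow_nz: "g \<noteq> 0 \<Longrightarrow> x \<noteq> 0 \<Longrightarrow> (om g ^^ n) x \<noteq> 0"
  by (induction n) (auto simp: om_nz)

lemma om_mult_cj:
  assumes "g \<noteq> 0" "x \<noteq> 0"
  shows "om g x * cj g x = x"
  using assms by (simp add: om_def mult.assoc cj_eq_0_iff)

lemma om_eq_1_iff:
  assumes "g \<noteq> 0" "x \<noteq> 0"
  shows "om g x = 1 \<longleftrightarrow> g * x = x * g"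
proof
  assume "om g x = 1"
  then have "cj g x = x"
    using om_mult_cj [OF assms] by simp
  then show "g * x = x * g"
    using assms by (simp add: cj_eq_iff)
next
  assume "g * x = x * g"
  then have "cj g x = x"
    using assms by (simp add: cj_eq_iff)
  then show "om g x = 1"
    using assms by (simp add: om_def)
qed

text \<open>With \<open>k\<close> fixed by \<open>\<sigma>\<close>, each application of \<open>\<delta>\<close> contributes a left factor \<open>1 - k\<close>. If \<open>u \<noteq> 0\<close>,
  then \<open>\<delta>\<^sup>n u = 0\<close> therefore forces \<open>k = 1\<close>, whatever the characteristic.\<close>

lemma dl_eigen:
  assumes "h \<noteq> 0" "cj h u = k * u" "cj h k = k"
  shows "(dl h ^^ n) u = (1 - k) ^ n * u"
proof (induction n)
  case (Suc n)
  have "cj h ((1 - k) ^ n) = (1 - k) ^ n"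
    by (induction n) (use assms in \<open>auto simp: cj_mult cj_1 cj_diff\<close>)
  then have "dl h ((1 - k) ^ n * u) = (1 - k) ^ n * u - (1 - k) ^ n * (k * u)"
    using assms by (simp add: dl_def cj_mult)
  then have "(dl h ^^ Suc n) u = (1 - k) ^ n * u - (1 - k) ^ n * (k * u)"
    using Suc by simp
  also have "\<dots> = (1 - k) ^ Suc n * u"
    by (simp add: power_Suc2 algebra_simps del: power_Suc)
  finally show ?case .
qed simp

lemma dl_eigen_nilpotent:
  assumes "h \<noteq> 0" "cj h u = k * u" "cj h k = k" "u \<noteq> 0" "(dl h ^^ n) u = 0"
  shows "k = 1"
  using dl_eigen [OF assms(1-3), of n] assms(4,5) by (auto simp: power_0_left)

text \<open>If \<open>f = \<omega> u\<close> is fixed by \<open>\<sigma>\<close>, then \<open>\<sigma> u = f\<^sup>-\<^sup>1 u\<close>, so the preceding lemma applies to \<open>u\<close>.\<close>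

lemma om_nilpotent_step:
  assumes "g \<noteq> 0" "u \<noteq> 0" "om g (om g u) = 1" "(dl g ^^ m) u = 0"
  shows "om g u = 1"
proof -
  define f where "f = om g u"
  have f: "f \<noteq> 0" "cj g f = f"
    using assms om_eq_1_iff [of g f] cj_eq_iff [of g f f] by (auto simp: f_def om_nz)
  have "f * cj g u = u"
    using assms by (simp add: f_def om_mult_cj)
  then have "inverse f * u = inverse f * f * cj g u"
    by (simp only: mult.assoc)
  then have "cj g u = inverse f * u"
    using f by simp
  moreover have "cj g (inverse f) = inverse f"
    using f assms by (simp add: cj_inverse)
  ultimately have "inverse f = 1"
    using dl_eigen_nilpotent assms by blast
  then show ?thesis
    using f by (metis f_def inverse_1 nonzero_inverse_inverse_eq)
qed

lemma om_nilpotent: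
  assumes "g \<noteq> 0" "x \<noteq> 0" "\<And>n. (dl g ^^ m) ((om g ^^ n) x) = 0"
    and "(om g ^^ Suc n) x = 1"
  shows "g * x = x * g"
  using assms(4)
proof (induction n)
  case 0
  then show ?case
    using assms om_eq_1_iff by fastforce
next
  case (Suc n)
  then show ?case
    using om_nilpotent_step [of g "(om g ^^ n) x" m] assms om_funpow_nz [of g x n] by simp
qed

section \<open>Division subrings\<close>

lemma division_subringD:
  assumes "division_subring K"
  shows "0 \<in> K" "1 \<in> K" "x \<in> K \<Longrightarrow> y \<in> K \<Longrightarrow> x - y \<in> K" "x \<in> K \<Longrightarrow> y \<in> K \<Longrightarrow> x * y \<in> K"
    "x \<in> K \<Longrightarrow> inverse x \<in> K" "x \<in> K \<Longrightarrow> - x \<in> K" "x \<in> K \<Longrightarrow> y \<in> K \<Longrightarrow> x + y \<in> K"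
proof -
  have *: "0 \<in> K" "1 \<in> K" "\<And>x y. x \<in> K \<Longrightarrow> y \<in> K \<Longrightarrow> x - y \<in> K"
     "\<And>x y. x \<in> K \<Longrightarrow> y \<in> K \<Longrightarrow> x * y \<in> K" "\<And>x. x \<in> K \<Longrightarrow> x \<noteq> 0 \<Longrightarrow> inverse x \<in> K"
    using assms by (auto simp: division_subring_def)
  show "0 \<in> K" "1 \<in> K" "x \<in> K \<Longrightarrow> y \<in> K \<Longrightarrow> x - y \<in> K" "x \<in> K \<Longrightarrow> y \<in> K \<Longrightarrow> x * y \<in> K"
    by (fact *)+
  show "x \<in> K \<Longrightarrow> inverse x \<in> K"
    using * by (cases "x = 0") auto
  show **: "- y \<in> K" if "y \<in> K" for y
    using *(3)[OF *(1) that] by simp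
  show "x \<in> K \<Longrightarrow> y \<in> K \<Longrightarrow> x + y \<in> K"
    using *(3)[of x "- y"] **[of y] by simp
qed

lemma division_subring_sum:
  assumes "division_subring K" "\<And>i. i \<in> I \<Longrightarrow> f i \<in> K"
  shows "sum f I \<in> K"
  using assms(2) by (induction I rule: infinite_finite_induct)
    (auto intro: division_subringD [OF assms(1)])

lemma division_subring_power:
  assumes "division_subring K" "x \<in> K"
  shows "x ^ n \<in> K"
  by (induction n) (auto intro: division_subringD [OF assms(1)] assms)

lemma division_subring_UNIV: "division_subring UNIV"
  by (simp add: division_subring_def)

lemma commute_inverse:
  fixes x :: "'a::division_ring"
  assumes "x * s = s * x"
  shows "inverse x * s = s * inverse x"
proof (cases "x = 0")
  case False
  have "inverse x * s = inverse x * (s * x) * inverse x"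
    using False by (simp add: mult.assoc)
  also have "\<dots> = (inverse x * x) * s * inverse x"
    by (simp only: assms [symmetric] mult.assoc)
  finally show ?thesis
    using False by simp
qed simp

lemma division_subring_centralizer: "division_subring (centralizer S)"
  unfolding division_subring_def centralizer_def
proof (safe, goal_cases)
  case (4 x y s)
  then have "y * s = s * y" "x * s = s * x"
    by auto
  then show ?case by (metis mult.assoc)
qed (auto intro: commute_inverse simp: algebra_simps)

lemma division_subring_Int:
  "division_subring K \<Longrightarrow> division_subring L \<Longrightarrow> division_subring (K \<inter> L)"
  by (auto simp: division_subring_def)

lemma ring_center_eq: "ring_center = centralizer UNIV"
  by (auto simp: ring_center_def centralizer_def)

lemma division_subring_center: "division_subring ring_center"
  unfolding ring_center_eq by (rule division_subring_centralizer)

lemma centerD: "t \<in> ring_center \<Longrightarrow> t * x = x * t"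
  by (simp add: ring_center_def)

lemma center_power: "t \<in> ring_center \<Longrightarrow> t ^ n \<in> ring_center"
  by (rule division_subring_power [OF division_subring_center])

section \<open>Polynomial functions of a central variable\<close>

text \<open>\<open>poly_fun S n p\<close>: on the center, \<open>p\<close> agrees with a polynomial of degree less than \<open>n\<close> whose
  coefficients lie in \<open>S\<close>. Polynomials are represented by the functions that they induce on
  the center; when the center is infinite nothing is lost by this. Values outside the center are irrelevant.\<close>

definition poly_fun :: "'a::division_ring set \<Rightarrow> nat \<Rightarrow> ('a \<Rightarrow> 'a) \<Rightarrow> bool" where
  "poly_fun S n p \<longleftrightarrow>
    (\<exists>a. (\<forall>i<n. a i \<in> S) \<and> (\<forall>t\<in>ring_center. p t = (\<Sum>i<n. a i * t ^ i)))"

lemma zero_center: "0 \<in> ring_center"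
  using division_subringD(1) [OF division_subring_center] .

lemma poly_fun_0: "poly_fun S 0 p \<longleftrightarrow> (\<forall>t\<in>ring_center. p t = 0)"
  by (auto simp: poly_fun_def)

text \<open>Horner form, the basis of most inductions on the degree below.\<close>

lemma poly_fun_Suc:
  "poly_fun S (Suc n) p \<longleftrightarrow>
    (\<exists>a\<in>S. \<exists>p'. poly_fun S n p' \<and> (\<forall>t\<in>ring_center. p t = a + t * p' t))" (is "?L \<longleftrightarrow> ?R")
proof -
  have shift: "(\<Sum>i<Suc n. a i * t ^ i) = a 0 + t * (\<Sum>i<n. a (Suc i) * t ^ i)"
    if "t \<in> ring_center" for a and t :: 'a
  proof -
    have "a (Suc i) * t ^ Suc i = t * (a (Suc i) * t ^ i)" for i
      using centerD [OF that, of "a (Suc i)"] by (simp add: mult.assoc [symmetric])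
    then show ?thesis
      by (simp add: sum.lessThan_Suc_shift sum_distrib_left del: sum.lessThan_Suc power_Suc)
  qed
  show ?thesis
  proof
    assume ?L
    then obtain a where a: "\<forall>i<Suc n. a i \<in> S"
        "\<forall>t\<in>ring_center. p t = (\<Sum>i<Suc n. a i * t ^ i)"
      unfolding poly_fun_def by blast
    show ?R
    proof (intro bexI exI conjI ballI)
      show "poly_fun S n (\<lambda>t. \<Sum>i<n. a (Suc i) * t ^ i)"
        unfolding poly_fun_def using a by (intro exI [of _ "\<lambda>i. a (Suc i)"]) auto
    qed (use a shift in auto)
  next
    assume ?R
    then obtain a0 p' a where a: "a0 \<in> S" "\<forall>t\<in>ring_center. p t = a0 + t * p' t"
        "\<forall>i<n. a i \<in> S" "\<forall>t\<in>ring_center. p' t = (\<Sum>i<n. a i * t ^ i)"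
      unfolding poly_fun_def by blast
    define b where "b = (\<lambda>i. case i of 0 \<Rightarrow> a0 | Suc i \<Rightarrow> a i)"
    have "p t = (\<Sum>i<Suc n. b i * t ^ i)" if "t \<in> ring_center" for t
      using a shift [OF that, of b] that by (simp add: b_def del: sum.lessThan_Suc)
    moreover have "\<forall>i<Suc n. b i \<in> S"
      using a by (auto simp: b_def split: nat.split)
    ultimately show ?L
      unfolding poly_fun_def by blast
  qed
qed

lemma poly_fun_cong:
  "poly_fun S n p \<Longrightarrow> (\<And>t. t \<in> ring_center \<Longrightarrow> p t = q t) \<Longrightarrow> poly_fun S n q"
  by (auto simp: poly_fun_def)

lemma poly_fun_mono:
  assumes "poly_fun S n p" "n \<le> m" "S \<subseteq> T" "0 \<in> T"
  shows "poly_fun T m p"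
proof -
  obtain a where a: "\<forall>i<n. a i \<in> S" "\<forall>t\<in>ring_center. p t = (\<Sum>i<n. a i * t ^ i)"
    using assms(1) unfolding poly_fun_def by blast
  define b where "b = (\<lambda>i. if i < n then a i else 0)"
  have "p t = (\<Sum>i<m. b i * t ^ i)" if "t \<in> ring_center" for t
  proof -
    have "p t = (\<Sum>i<n. b i * t ^ i)"
      using a that by (simp add: b_def)
    also have "\<dots> = (\<Sum>i<m. b i * t ^ i)"
      by (rule sum.mono_neutral_left) (use assms in \<open>auto simp: b_def\<close>)
    finally show ?thesis .
  qed
  moreover have "\<forall>i<m. b i \<in> T"
    using a assms by (auto simp: b_def)
  ultimately show ?thesis
    unfolding poly_fun_def by blast
qed

lemma poly_fun_map:
  assumes "poly_fun S n p" "\<And>x y. f (x + y) = f x + f y"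
    "\<And>t x. t \<in> ring_center \<Longrightarrow> f (x * t) = f x * t" "\<And>x. x \<in> S \<Longrightarrow> f x \<in> T"
  shows "poly_fun T n (\<lambda>t. f (p t))"
proof -
  obtain a where a: "\<forall>i<n. a i \<in> S" "\<forall>t\<in>ring_center. p t = (\<Sum>i<n. a i * t ^ i)"
    using assms(1) unfolding poly_fun_def by blast
  have "f 0 = 0"
    using assms(2) [of 0 0] by simp
  then have "f (\<Sum>i\<in>I. h i) = (\<Sum>i\<in>I. f (h i))" for I and h :: "nat \<Rightarrow> 'a"
    by (induction I rule: infinite_finite_induct) (auto simp: assms)
  then have "f (p t) = (\<Sum>i<n. f (a i) * t ^ i)" if "t \<in> ring_center" for t
    using a that assms(3) [OF center_power [OF that]] by simp
  then show ?thesis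
    unfolding poly_fun_def using a(1) assms(4) by (intro exI [of _ "\<lambda>i. f (a i)"]) simp
qed

lemma poly_fun_add:
  assumes "division_subring S" "poly_fun S n p" "poly_fun S n q"
  shows "poly_fun S n (\<lambda>t. p t + q t)"
proof -
  obtain a b where a: "\<forall>i<n. a i \<in> S" "\<forall>t\<in>ring_center. p t = (\<Sum>i<n. a i * t ^ i)"
    and b: "\<forall>i<n. b i \<in> S" "\<forall>t\<in>ring_center. q t = (\<Sum>i<n. b i * t ^ i)"
    using assms(2,3) unfolding poly_fun_def by blast
  then show ?thesis
    unfolding poly_fun_def
    by (intro exI [of _ "\<lambda>i. a i + b i"])
       (auto simp: algebra_simps sum.distrib intro: division_subringD [OF assms(1)])
qed

lemma poly_fun_cmult:
  assumes "division_subring S" "poly_fun S n p" "c \<in> S"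
  shows "poly_fun S n (\<lambda>t. c * p t)" "poly_fun S n (\<lambda>t. p t * c)"
proof -
  show "poly_fun S n (\<lambda>t. c * p t)"
    by (rule poly_fun_map [OF assms(2)])
       (simp_all add: distrib_left mult.assoc assms division_subringD(4) [OF assms(1)])
  show "poly_fun S n (\<lambda>t. p t * c)"
    by (rule poly_fun_map [OF assms(2)])
       (simp_all add: distrib_right mult.assoc centerD [of _ c] assms
          division_subringD(4) [OF assms(1)])
qed

lemma poly_fun_diff:
  assumes "division_subring S" "poly_fun S n p" "poly_fun S n q"
  shows "poly_fun S n (\<lambda>t. p t - q t)"
proof -
  have "- 1 \<in> S"
    by (intro division_subringD [OF assms(1)])
  then have "poly_fun S n (\<lambda>t. p t + - 1 * q t)"
    using assms by (intro poly_fun_add poly_fun_cmult) auto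
  then show ?thesis
    by simp
qed

lemma poly_fun_shift:
  assumes "0 \<in> S" "poly_fun S n p"
  shows "poly_fun S (Suc n) (\<lambda>t. t * p t)"
  unfolding poly_fun_Suc
  by (intro bexI [of _ 0] exI [of _ p]) (simp_all add: assms)

lemma poly_fun_const: "c \<in> S \<Longrightarrow> poly_fun S (Suc 0) (\<lambda>t. c)"
  unfolding poly_fun_def by (intro exI [of _ "\<lambda>i. c"]) auto

lemma poly_fun_mult:
  assumes S: "division_subring S" and "poly_fun S n p" "poly_fun S m q"
  shows "poly_fun S (n + m) (\<lambda>t. p t * q t)"
  using assms(2)
proof (induction n arbitrary: p)
  case 0
  then have "poly_fun S 0 (\<lambda>t. p t * q t)"
    by (simp add: poly_fun_0)
  then show ?case
    by (rule poly_fun_mono) (auto intro: division_subringD [OF S])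
next
  case (Suc n)
  then obtain a p' where p: "a \<in> S" "poly_fun S n p'" "\<forall>t\<in>ring_center. p t = a + t * p' t"
    unfolding poly_fun_Suc by blast
  have "poly_fun S (Suc (n + m)) (\<lambda>t. a * q t + t * (p' t * q t))"
  proof (intro poly_fun_add [OF S])
    show "poly_fun S (Suc (n + m)) (\<lambda>t. a * q t)"
      by (rule poly_fun_mono [OF poly_fun_cmult(1) [OF S assms(3) p(1)]])
         (auto simp: division_subringD(1) [OF S])
    show "poly_fun S (Suc (n + m)) (\<lambda>t. t * (p' t * q t))"
      by (rule poly_fun_shift [OF division_subringD(1) [OF S] Suc.IH [OF p(2)]])
  qed
  then have "poly_fun S (Suc (n + m)) (\<lambda>t. p t * q t)"
    by (rule poly_fun_cong) (simp add: p algebra_simps)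
  then show ?case
    by simp
qed

lemma poly_fun_factor:
  assumes "poly_fun UNIV (Suc n) p" "s \<in> ring_center"
  shows "\<exists>h. poly_fun UNIV n h \<and> (\<forall>t\<in>ring_center. p t = p s + (t - s) * h t)"
  using assms(1)
proof (induction n arbitrary: p)
  case 0
  then show ?case
    using assms(2) by (auto simp: poly_fun_Suc poly_fun_0)
next
  case (Suc n)
  then obtain a p' where p: "poly_fun UNIV (Suc n) p'" "\<forall>t\<in>ring_center. p t = a + t * p' t"
    unfolding poly_fun_Suc [of _ "Suc n"] by blast
  obtain h where h: "poly_fun UNIV n h" "\<forall>t\<in>ring_center. p' t = p' s + (t - s) * h t"
    using Suc.IH [OF p(1)] by blast
  have "poly_fun UNIV (Suc n) (\<lambda>t. p' s + t * h t)"
    unfolding poly_fun_Suc using h by auto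
  moreover have "p t = p s + (t - s) * (p' s + t * h t)" if t: "t \<in> ring_center" for t
  proof -
    have "p t - p s = t * (p' s + (t - s) * h t) - s * p' s"
      using p(2) assms(2) t bspec [OF h(2) t] by simp
    also have "t * (p' s + (t - s) * h t) = t * p' s + (t - s) * (t * h t)"
      using centerD [OF t, of "t - s"] by (simp add: distrib_left mult.assoc [symmetric])
    also have "\<dots> - s * p' s = (t - s) * (p' s + t * h t)"
      by (simp add: algebra_simps)
    finally show ?thesis
      by (simp add: algebra_simps)
  qed
  ultimately show ?case
    by blast
qed

lemma poly_fun_zeros:
  assumes "poly_fun UNIV n p" "infinite {t \<in> ring_center. p t = 0}"
  shows "\<forall>t\<in>ring_center. p t = 0"
  using assms
proof (induction n arbitrary: p)
  case 0
  then show ?case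
    by (simp add: poly_fun_0)
next
  case (Suc n)
  obtain s where s: "s \<in> ring_center" "p s = 0"
    using Suc.prems(2) by (metis (mono_tags, lifting) Collect_empty_eq finite.emptyI)
  obtain h where h: "poly_fun UNIV n h" "\<forall>t\<in>ring_center. p t = (t - s) * h t"
    using poly_fun_factor [OF Suc.prems(1) s(1)] s(2) by auto
  have "{t \<in> ring_center. p t = 0} \<subseteq> insert s {t \<in> ring_center. h t = 0}"
    using h by auto
  then have "infinite {t \<in> ring_center. h t = 0}"
    using Suc.prems(2) by (meson finite_insert finite_subset)
  then have "\<forall>t\<in>ring_center. h t = 0"
    by (rule Suc.IH [OF h(1)])
  then show ?case
    by (metis h(2) mult_zero_right)
qed

text \<open>More than \<open>n\<close> polynomials of degree less than \<open>n\<close> are right linearly dependent over \<open>S\<close>. The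
  proof is Gaussian elimination on the constant coefficients.\<close>

lemma poly_fun_dependent:
  assumes S: "division_subring S" and "finite I" "card I > n" "\<forall>i\<in>I. poly_fun S n (f i)"
  shows "\<exists>s. (\<forall>i\<in>I. s i \<in> S) \<and> (\<exists>i\<in>I. s i \<noteq> 0) \<and> (\<forall>t\<in>ring_center. (\<Sum>i\<in>I. f i t * s i) = 0)"
  using assms(2-)
proof (induction n arbitrary: I f)
  case 0
  then have "I \<noteq> {}"
    by auto
  with 0 show ?case
    by (intro exI [of _ "\<lambda>i. 1"]) (auto simp: poly_fun_0 division_subringD [OF S])
next
  case (Suc n)
  have "\<forall>i\<in>I. \<exists>a p'. a \<in> S \<and> poly_fun S n p' \<and> (\<forall>t\<in>ring_center. f i t = a + t * p' t)"
    using Suc.prems(3) unfolding poly_fun_Suc by blast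
  then obtain a f' where a: "\<And>i. i \<in> I \<Longrightarrow> a i \<in> S" and f': "\<And>i. i \<in> I \<Longrightarrow> poly_fun S n (f' i)"
    and f: "\<And>i t. i \<in> I \<Longrightarrow> t \<in> ring_center \<Longrightarrow> f i t = a i + t * f' i t"
    by metis
  show ?case
  proof (cases "\<forall>i\<in>I. a i = 0")
    case True
    obtain s where s: "\<forall>i\<in>I. s i \<in> S" "\<exists>i\<in>I. s i \<noteq> 0"
        "\<forall>t\<in>ring_center. (\<Sum>i\<in>I. f' i t * s i) = 0"
      using Suc.IH [of I f'] Suc.prems f' by auto
    \<comment> \<open>All constant terms vanish: divide by \<open>t\<close>.\<close>
    have "(\<Sum>i\<in>I. f i t * s i) = t * (\<Sum>i\<in>I. f' i t * s i)" if "t \<in> ring_center" for t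
      using f True that by (simp add: sum_distrib_left mult.assoc)
    with s show ?thesis
      by (intro exI [of _ s]) auto
  next
    case False
    then obtain j where j: "j \<in> I" "a j \<noteq> 0"
      by blast
    \<comment> \<open>Use \<open>f j\<close> as pivot: \<open>f i - f j * c i\<close> has constant term zero, and its quotient by \<open>t\<close> is \<open>g i\<close>.\<close>
    define c where "c = (\<lambda>i. inverse (a j) * a i)"
    have c: "c i \<in> S" if "i \<in> I" for i
      using a j that by (auto simp: c_def intro: division_subringD [OF S])
    define g where "g = (\<lambda>i t. f' i t - f' j t * c i)"
    have "poly_fun S n (g i)" if "i \<in> I - {j}" for i
      unfolding g_def using that j f' c by (intro poly_fun_diff [OF S] poly_fun_cmult [OF S]) auto
    moreover have "card (I - {j}) > n"
      using Suc.prems j by simp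
    ultimately obtain s where s: "\<forall>i\<in>I-{j}. s i \<in> S" "\<exists>i\<in>I-{j}. s i \<noteq> 0"
        "\<forall>t\<in>ring_center. (\<Sum>i\<in>I-{j}. g i t * s i) = 0"
      using Suc.IH [of "I - {j}" g] Suc.prems(1) by auto
    define s' where "s' = (\<lambda>i. if i = j then - (\<Sum>i\<in>I-{j}. c i * s i) else s i)"
    have "(\<Sum>i\<in>I. f i t * s' i) = 0" if t: "t \<in> ring_center" for t
    proof -
      have g: "f i t - f j t * c i = t * g i t" if "i \<in> I" for i
      proof -
        have "a j * c i = a i"
          using j by (simp add: c_def mult.assoc [symmetric])
        then show ?thesis
          using f [OF that t] f [OF j(1) t] by (simp add: g_def algebra_simps)
      qed
      have "(\<Sum>i\<in>I. f i t * s' i) = f j t * s' j + (\<Sum>i\<in>I-{j}. f i t * s' i)"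
        using j Suc.prems(1) by (simp add: sum.remove)
      also have "\<dots> = (\<Sum>i\<in>I-{j}. f i t * s i) - f j t * (\<Sum>i\<in>I-{j}. c i * s i)"
        by (simp add: s'_def)
      also have "\<dots> = (\<Sum>i\<in>I-{j}. (f i t - f j t * c i) * s i)"
        by (simp add: sum_subtractf sum_distrib_left algebra_simps)
      also have "\<dots> = t * (\<Sum>i\<in>I-{j}. g i t * s i)"
        using g by (simp add: sum_distrib_left mult.assoc)
      finally show ?thesis
        using s(3) t by simp
    qed
    moreover have "\<forall>i\<in>I. s' i \<in> S"
      using s(1) c by (auto simp: s'_def intro!: division_subringD(6) [OF S]
          division_subringD(4) [OF S] division_subring_sum [OF S])
    moreover have "\<exists>i\<in>I. s' i \<noteq> 0"
      using s(2) by (auto simp: s'_def)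
    ultimately show ?thesis
      by blast
  qed
qed

text \<open>The Ore condition, with a denominator \<open>b\<close> that does not vanish at zero: this is what turns a product
  \<open>q\<^sup>-\<^sup>1 p\<close> into a right fraction \<open>a b\<^sup>-\<^sup>1\<close>. A dependence among the \<open>q t\<^sup>i\<close> and \<open>p t\<^sup>i\<close> provides \<open>a\<close> and
  \<open>b\<close>, not both zero; common factors \<open>t\<close> are then cancelled until \<open>b 0 \<noteq> 0\<close>.\<close>

lemma poly_fun_common_multiple:
  assumes inf: "infinite (ring_center :: 'a::division_ring set)"
    and S: "division_subring S" and q: "poly_fun S n q" and p: "poly_fun S n p"
    and "q (0::'a) \<noteq> 0"
  shows "\<exists>m a b. poly_fun S m a \<and> poly_fun S m b \<and> b 0 \<noteq> 0
    \<and> (\<forall>t\<in>ring_center. q t * a t = p t * b t)"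
proof -
  have strip: "\<exists>a b. poly_fun S k a \<and> poly_fun S k b \<and> b 0 \<noteq> 0
      \<and> (\<forall>t\<in>ring_center. q t * a t = p t * b t)"
    if "\<forall>i<k. \<alpha> i \<in> S \<and> \<beta> i \<in> S" "\<exists>i<k. \<alpha> i \<noteq> 0 \<or> \<beta> i \<noteq> 0"
      "\<forall>t\<in>ring_center. q t * (\<Sum>i<k. \<alpha> i * t ^ i) = p t * (\<Sum>i<k. \<beta> i * t ^ i)" for k \<alpha> \<beta>
    using that
  proof (induction k arbitrary: \<alpha> \<beta>)
    case 0
    then show ?case by simp
  next
    case (Suc k)
    show ?case
    proof (cases "\<beta> 0 = 0")
      case False
      have "poly_fun S (Suc k) (\<lambda>t. \<Sum>i<Suc k. \<alpha> i * t ^ i)"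
        "poly_fun S (Suc k) (\<lambda>t. \<Sum>i<Suc k. \<beta> i * t ^ i)"
        unfolding poly_fun_def using Suc.prems(1) by blast+
      moreover have "(\<Sum>i<Suc k. \<beta> i * 0 ^ i) \<noteq> 0"
        using False by (simp add: sum.lessThan_Suc_shift del: sum.lessThan_Suc)
      ultimately show ?thesis
        using Suc.prems(3) by blast
    next
      case True
      have "q 0 * (\<Sum>i<Suc k. \<alpha> i * 0 ^ i) = p 0 * (\<Sum>i<Suc k. \<beta> i * 0 ^ i)"
        using Suc.prems(3) zero_center by blast
      \<comment> \<open>If \<open>b\<close> vanishes at zero, then so does \<open>a\<close>, because \<open>q 0 \<noteq> 0\<close>.\<close>
      then have "\<alpha> 0 = 0"
        using True \<open>q 0 \<noteq> 0\<close> by (simp add: sum.lessThan_Suc_shift del: sum.lessThan_Suc)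
      have shift: "(\<Sum>i<Suc k. c i * t ^ i) = (\<Sum>i<k. c (Suc i) * t ^ i) * t"
        if "c 0 = 0" for c and t :: 'a
        using that by (simp add: sum.lessThan_Suc_shift sum_distrib_right mult.assoc power_Suc2
              del: sum.lessThan_Suc power_Suc)
      define a where "a = (\<lambda>t. \<Sum>i<k. \<alpha> (Suc i) * t ^ i)"
      define b where "b = (\<lambda>t. \<Sum>i<k. \<beta> (Suc i) * t ^ i)"
      have eq: "q t * a t = p t * b t" if "t \<in> ring_center" "t \<noteq> 0" for t
      proof -
        have "q t * a t * t = p t * b t * t"
          using bspec [OF Suc.prems(3) that(1)] shift [of \<alpha>] shift [of \<beta>] True \<open>\<alpha> 0 = 0\<close>
          by (simp add: mult.assoc a_def b_def del: sum.lessThan_Suc)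
        then show ?thesis
          using that by simp
      qed
      have ab: "poly_fun S k a" "poly_fun S k b"
        unfolding poly_fun_def a_def b_def using Suc.prems(1)
        by (intro exI [of _ "\<lambda>i. \<alpha> (Suc i)"] exI [of _ "\<lambda>i. \<beta> (Suc i)"]; simp)+
      have "poly_fun S (n + k) (\<lambda>t. q t * a t - p t * b t)"
        by (intro poly_fun_diff poly_fun_mult S q p ab)
      then have "poly_fun UNIV (n + k) (\<lambda>t. q t * a t - p t * b t)"
        by (rule poly_fun_mono) auto
      moreover have "ring_center - {0} \<subseteq> {t \<in> ring_center. q t * a t - p t * b t = 0}"
        using eq by auto
      then have "infinite {t \<in> ring_center. q t * a t - p t * b t = 0}"
        using inf by (meson finite_subset infinite_remove)
      ultimately have "\<forall>t\<in>ring_center. q t * a t - p t * b t = 0"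
        by (rule poly_fun_zeros)
      then have "\<forall>t\<in>ring_center. q t * a t = p t * b t"
        by simp
      moreover have "\<exists>i<k. \<alpha> (Suc i) \<noteq> 0 \<or> \<beta> (Suc i) \<noteq> 0"
        using Suc.prems(2) True \<open>\<alpha> 0 = 0\<close> by (metis Suc_less_eq not0_implies_Suc)
      ultimately have "\<exists>a b. poly_fun S k a \<and> poly_fun S k b \<and> b 0 \<noteq> 0
          \<and> (\<forall>t\<in>ring_center. q t * a t = p t * b t)"
        using Suc.IH [of "\<lambda>i. \<alpha> (Suc i)" "\<lambda>i. \<beta> (Suc i)"] Suc.prems(1) by (simp add: a_def b_def)
      then show ?thesis
        using poly_fun_mono [of S k _ "Suc k" S] division_subringD(1) [OF S]
        by (metis le_Suc_eq order_refl)
    qed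
  qed
  \<comment> \<open>There are \<open>2 k\<close> functions of degree less than \<open>n + k\<close>, and \<open>2 k > n + k\<close>.\<close>
  define k where "k = Suc n"
  have power: "poly_fun S (n + i) (\<lambda>t. r t * t ^ i)" if "poly_fun S n r" for r i
  proof (induction i)
    case (Suc i)
    have "poly_fun S (Suc (n + i)) (\<lambda>t. t * (r t * t ^ i))"
      by (intro poly_fun_shift division_subringD(1) [OF S] Suc)
    moreover have "t * (r t * t ^ i) = r t * t ^ Suc i" if "t \<in> ring_center" for t
      using centerD [OF that, of "r t"] by (simp add: mult.assoc [symmetric])
    ultimately have "poly_fun S (Suc (n + i)) (\<lambda>t. r t * t ^ Suc i)"
      by (rule poly_fun_cong)
    then show ?case
      by simp
  qed (simp add: that)
  define f where "f = (\<lambda>(b, i) t. (if b then q t else - p t) * t ^ i)"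
  have "poly_fun S n (\<lambda>t. (0 * p t) - p t)"
    by (intro poly_fun_diff poly_fun_cmult S p division_subringD [OF S])
  then have p': "poly_fun S n (\<lambda>t. - p t)"
    by simp
  have "poly_fun S (n + k) (f x)" if x: "x \<in> (UNIV :: bool set) \<times> {..<k}" for x
  proof -
    obtain b i where x: "x = (b, i)" "i < k"
      using x by auto
    have "poly_fun S (n + i) (f x)"
      using power [OF q, of i] power [OF p', of i] by (cases b) (simp_all add: x f_def)
    then show ?thesis
      by (rule poly_fun_mono) (use x division_subringD(1) [OF S] in auto)
  qed
  moreover have "card ((UNIV :: bool set) \<times> {..<k}) > n + k"
    by (simp add: k_def)
  ultimately obtain s where s: "\<forall>x\<in>(UNIV :: bool set) \<times> {..<k}. s x \<in> S"
      "\<exists>x\<in>(UNIV :: bool set) \<times> {..<k}. s x \<noteq> 0"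
      "\<forall>t\<in>ring_center. (\<Sum>x\<in>(UNIV :: bool set) \<times> {..<k}. f x t * s x) = 0"
    using poly_fun_dependent [OF S, of "(UNIV :: bool set) \<times> {..<k}" "n + k" f] by auto
  have "q t * (\<Sum>i<k. s (True, i) * t ^ i) = p t * (\<Sum>i<k. s (False, i) * t ^ i)"
    if t: "t \<in> ring_center" for t
  proof -
    have "t ^ i * x = x * t ^ i" for i x
      using centerD [OF center_power [OF t]] .
    moreover have "(\<Sum>x\<in>(UNIV :: bool set) \<times> {..<k}. f x t * s x)
      = (\<Sum>i<k. q t * t ^ i * s (True, i)) - (\<Sum>i<k. p t * t ^ i * s (False, i))"
      by (simp add: sum.cartesian_product' UNIV_bool f_def sum_negf)
    ultimately show ?thesis
      using s(3) t by (simp add: sum_distrib_left mult.assoc)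
  qed
  moreover have "\<exists>i<k. s (True, i) \<noteq> 0 \<or> s (False, i) \<noteq> 0"
  proof -
    obtain b i where "i < k" "s (b, i) \<noteq> 0"
      using s(2) by blast
    then show ?thesis
      by (cases b) auto
  qed
  moreover have "\<forall>i<k. s (True, i) \<in> S \<and> s (False, i) \<in> S"
    using s(1) by simp
  ultimately have "\<exists>a b. poly_fun S k a \<and> poly_fun S k b \<and> b 0 \<noteq> 0
      \<and> (\<forall>t\<in>ring_center. q t * a t = p t * b t)"
    by (intro strip [of k "\<lambda>i. s (True, i)" "\<lambda>i. s (False, i)"]) simp_all
  then show ?thesis
    by (rule exI)
qed

section \<open>Rational functions regular at zero\<close>

text \<open>The filter of the cofinite subsets of the center: a property holds generically if it holds for all
  but finitely many central \<open>t\<close>.\<close>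

definition generic :: "'a::division_ring filter" where
  "generic = inf cofinite (principal ring_center)"

lemma eventually_generic: "eventually P generic \<longleftrightarrow> finite {t \<in> ring_center. \<not> P t}"
  by (auto simp: generic_def eventually_inf_principal eventually_cofinite
      intro!: arg_cong [where f = finite])

lemma eventually_generic_center: "eventually (\<lambda>t. t \<in> ring_center) generic"
  by (simp add: eventually_generic)

lemma eventually_generic_nonzero: "eventually (\<lambda>t. t \<noteq> 0) generic"
  by (rule eventually_generic [THEN iffD2], rule finite_subset [of _ "{0}"]) auto

lemma eventually_generic_infinite:
  assumes "eventually P generic" "infinite T" "T \<subseteq> ring_center"
  shows "infinite {t \<in> T. P t}"
proof
  assume "finite {t \<in> T. P t}"
  then have "finite ({t \<in> T. P t} \<union> {t \<in> ring_center. \<not> P t})"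
    using assms(1) by (simp add: eventually_generic)
  moreover have "T \<subseteq> {t \<in> T. P t} \<union> {t \<in> ring_center. \<not> P t}"
    using assms(3) by auto
  ultimately show False
    using assms(2) finite_subset by blast
qed

text \<open>\<open>regular S f\<close>: generically, and at \<open>0\<close>, the function \<open>f\<close> is a right fraction \<open>p q\<^sup>-\<^sup>1\<close> of polynomials over
  \<open>S\<close> with \<open>q 0 \<noteq> 0\<close>. Finitely many other central points are exempt, so that the convention
  \<open>inverse 0 = 0\<close> does no harm.\<close>

definition regular :: "'a::division_ring set \<Rightarrow> ('a \<Rightarrow> 'a) \<Rightarrow> bool" where
  "regular S f \<longleftrightarrow> (\<exists>n p q. poly_fun S n p \<and> poly_fun S n q \<and> q 0 \<noteq> 0 \<and> f 0 * q 0 = p 0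
     \<and> (\<forall>\<^sub>F t in generic. f t * q t = p t))"

lemma regularI:
  assumes "division_subring S" "poly_fun S n p" "poly_fun S m q" "q 0 \<noteq> 0" "f 0 * q 0 = p 0"
    "\<forall>\<^sub>F t in generic. f t * q t = p t"
  shows "regular S f"
proof -
  have "poly_fun S (max n m) p" "poly_fun S (max n m) q"
    using assms(2,3) poly_fun_mono [of S n p "max n m" S] poly_fun_mono [of S m q "max n m" S]
      division_subringD(1) [OF assms(1)] by auto
  then show ?thesis
    unfolding regular_def using assms by blast
qed

lemma regular_mono:
  assumes "regular S f"
  shows "regular UNIV f"
proof -
  have "poly_fun UNIV n p" if "poly_fun S n p" for n p
    using that by (rule poly_fun_mono) auto
  then show ?thesis
    using assms unfolding regular_def by blast
qed

lemma regular_poly_fun: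
  assumes "division_subring S" "poly_fun S n p"
  shows "regular S p"
  by (rule regularI [OF assms poly_fun_const [of 1]]) (simp_all add: division_subringD(2) [OF assms(1)])

lemma regular_linear:
  assumes "division_subring S" "a \<in> S" "b \<in> S"
  shows "regular S (\<lambda>t. a + t * b)"
proof (rule regular_poly_fun [OF assms(1)])
  show "poly_fun S (Suc (Suc 0)) (\<lambda>t. a + t * b)"
    unfolding poly_fun_Suc [of S "Suc 0"]
    by (rule bexI [OF _ assms(2)], rule exI [of _ "\<lambda>t. b"]) (simp add: poly_fun_const assms)
qed

lemma regular_const:
  assumes "division_subring S" "a \<in> S"
  shows "regular S (\<lambda>t. a)"
  by (rule regular_poly_fun [OF assms(1) poly_fun_const [OF assms(2)]])

lemma regular_map:
  assumes "regular S f" "\<And>x y. c (x + y) = c x + c y" "\<And>x y. c (x * y) = c x * c y"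
    "\<And>t. t \<in> ring_center \<Longrightarrow> c t = t" "\<And>x. c x = 0 \<longleftrightarrow> x = 0" "\<And>x. x \<in> S \<Longrightarrow> c x \<in> S"
  shows "regular S (\<lambda>t. c (f t))"
proof -
  obtain n p q where pq: "poly_fun S n p" "poly_fun S n q" "q 0 \<noteq> 0" "f 0 * q 0 = p 0"
     "\<forall>\<^sub>F t in generic. f t * q t = p t"
    using assms(1) unfolding regular_def by blast
  have "poly_fun S n (\<lambda>t. c (p t))" "poly_fun S n (\<lambda>t. c (q t))"
    by (rule poly_fun_map [where f = c, OF pq(1)], simp_all add: assms)
       (rule poly_fun_map [where f = c, OF pq(2)], simp_all add: assms)
  moreover have "\<forall>\<^sub>F t in generic. c (f t) * c (q t) = c (p t)"
    using pq(5) by eventually_elim (simp only: assms(3) [symmetric])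
  ultimately show ?thesis
    unfolding regular_def using pq(3,4) assms(3,5) by metis
qed

lemma regular_cj:
  assumes "regular S f" "g \<noteq> 0" "\<And>x. x \<in> S \<Longrightarrow> cj g x \<in> S"
  shows "regular S (\<lambda>t. cj g (f t))"
proof (rule regular_map [where c = "cj g", OF assms(1)])
  show "cj g t = t" if "t \<in> ring_center" for t
    using centerD [OF that, of g] cj_eq_iff [OF assms(2)] by simp
qed (simp_all add: cj_add cj_mult cj_eq_0_iff assms)

context
  assumes inf: "infinite (ring_center :: 'a::division_ring set)"
begin

lemma poly_fun_generic_zeros:
  assumes "poly_fun UNIV n (p :: 'a \<Rightarrow> 'a)" "\<forall>\<^sub>F t in generic. p t = 0"
  shows "\<forall>t\<in>ring_center. p t = 0"
  using poly_fun_zeros [OF assms(1)] eventually_generic_infinite [OF assms(2) inf] by simp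

lemma poly_fun_generic_nonzero:
  assumes "poly_fun S n (p :: 'a \<Rightarrow> 'a)" "s \<in> ring_center" "p s \<noteq> 0"
  shows "\<forall>\<^sub>F t in generic. p t \<noteq> 0"
proof -
  have "poly_fun UNIV n p"
    using assms(1) by (rule poly_fun_mono) auto
  then have "finite {t \<in> ring_center. p t = 0}"
    using poly_fun_zeros assms(2,3) by blast
  then show ?thesis
    by (simp add: eventually_generic)
qed

lemma regular_zeros:
  fixes f :: "'a \<Rightarrow> 'a"
  assumes "regular S f" "infinite {t \<in> ring_center. f t = 0}"
  shows "f 0 = 0" "\<forall>\<^sub>F t in generic. f t = 0"
proof -
  obtain n p q where pq: "poly_fun UNIV n p" "poly_fun UNIV n q" "q 0 \<noteq> 0" "f 0 * q 0 = p 0"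
     "\<forall>\<^sub>F t in generic. f t * q t = p t"
    using regular_mono [OF assms(1)] unfolding regular_def by blast
  have "infinite {t \<in> {t \<in> ring_center. f t = 0}. f t * q t = p t}"
    by (rule eventually_generic_infinite [OF pq(5) assms(2)]) auto
  moreover have "{t \<in> {t \<in> ring_center. f t = 0}. f t * q t = p t} \<subseteq> {t \<in> ring_center. p t = 0}"
    by auto
  ultimately have "infinite {t \<in> ring_center. p t = 0}"
    using finite_subset by blast
  then have p: "\<forall>t\<in>ring_center. p t = 0"
    by (rule poly_fun_zeros [OF pq(1)])
  then have "p 0 = 0"
    using zero_center by blast
  then show "f 0 = 0"
    using pq(3,4) by simp
  show "\<forall>\<^sub>F t in generic. f t = 0"
    using pq(5) poly_fun_generic_nonzero [OF pq(2) zero_center pq(3)] eventually_generic_center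
    by eventually_elim (use p in auto)
qed

lemma regular_generic_zero:
  assumes "regular S f" "\<forall>\<^sub>F t in generic. f t = (0 :: 'a)"
  shows "f 0 = 0"
  using regular_zeros(1) [OF assms(1)] eventually_generic_infinite [OF assms(2) inf] by simp

lemma regular_generic_nonzero:
  assumes "regular S f" "f 0 \<noteq> (0 :: 'a)"
  shows "\<forall>\<^sub>F t in generic. f t \<noteq> 0"
  using regular_zeros(1) [OF assms(1)] assms(2) by (auto simp: eventually_generic)

lemma regular_mult:
  fixes f g :: "'a \<Rightarrow> 'a"
  assumes S: "division_subring S" and f: "regular S f" and g: "regular S g"
  shows "regular S (\<lambda>t. f t * g t)"
proof -
  obtain n1 p1 q1 where 1: "poly_fun S n1 p1" "poly_fun S n1 q1" "q1 0 \<noteq> 0" "f 0 * q1 0 = p1 0"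
     "\<forall>\<^sub>F t in generic. f t * q1 t = p1 t"
    using f unfolding regular_def by blast
  obtain n2 p2 q2 where 2: "poly_fun S n2 p2" "poly_fun S n2 q2" "q2 0 \<noteq> 0" "g 0 * q2 0 = p2 0"
     "\<forall>\<^sub>F t in generic. g t * q2 t = p2 t"
    using g unfolding regular_def by blast
  have "poly_fun S (max n1 n2) q1" "poly_fun S (max n1 n2) p2"
    using 1(2) 2(1) poly_fun_mono [of S n1 q1 "max n1 n2" S] poly_fun_mono [of S n2 p2 "max n1 n2" S]
      division_subringD(1) [OF S] by auto
  then obtain m a b where ab: "poly_fun S m a" "poly_fun S m b" "b 0 \<noteq> 0"
      "\<forall>t\<in>ring_center. q1 t * a t = p2 t * b t"
    using poly_fun_common_multiple [OF inf S] 1(3) by blast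
  have *: "f t * g t * (q2 t * b t) = p1 t * a t"
    if "q1 t * a t = p2 t * b t" "f t * q1 t = p1 t" "g t * q2 t = p2 t" for t
  proof -
    have "f t * g t * (q2 t * b t) = f t * (g t * q2 t * b t)"
      by (simp only: mult.assoc)
    also have "\<dots> = f t * (p2 t * b t)"
      by (simp only: that(3))
    also have "\<dots> = f t * q1 t * a t"
      by (simp only: that(1) [symmetric] mult.assoc)
    finally show ?thesis
      by (simp only: that)
  qed
  show ?thesis
  proof (rule regularI [OF S])
    show "poly_fun S (n1 + m) (\<lambda>t. p1 t * a t)" "poly_fun S (n2 + m) (\<lambda>t. q2 t * b t)"
      by (intro poly_fun_mult S 1 2 ab)+
    show "f 0 * g 0 * (q2 0 * b 0) = p1 0 * a 0"
      using * [of 0] ab(4) zero_center 1(4) 2(4) by blast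
    show "\<forall>\<^sub>F t in generic. f t * g t * (q2 t * b t) = p1 t * a t"
      using 1(5) 2(5) eventually_generic_center
      by eventually_elim (use ab(4) * in blast)
  qed (use ab(3) 2(3) in simp)
qed

lemma regular_add:
  fixes f g :: "'a \<Rightarrow> 'a"
  assumes S: "division_subring S" and f: "regular S f" and g: "regular S g"
  shows "regular S (\<lambda>t. f t + g t)"
proof -
  obtain n1 p1 q1 where 1: "poly_fun S n1 p1" "poly_fun S n1 q1" "q1 0 \<noteq> 0" "f 0 * q1 0 = p1 0"
     "\<forall>\<^sub>F t in generic. f t * q1 t = p1 t"
    using f unfolding regular_def by blast
  obtain n2 p2 q2 where 2: "poly_fun S n2 p2" "poly_fun S n2 q2" "q2 0 \<noteq> 0" "g 0 * q2 0 = p2 0"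
     "\<forall>\<^sub>F t in generic. g t * q2 t = p2 t"
    using g unfolding regular_def by blast
  have "poly_fun S (max n1 n2) q1" "poly_fun S (max n1 n2) q2"
    using 1(2) 2(2) poly_fun_mono [of S n1 q1 "max n1 n2" S] poly_fun_mono [of S n2 q2 "max n1 n2" S]
      division_subringD(1) [OF S] by auto
  then obtain m a b where ab: "poly_fun S m a" "poly_fun S m b" "b 0 \<noteq> 0"
      "\<forall>t\<in>ring_center. q1 t * a t = q2 t * b t"
    using poly_fun_common_multiple [OF inf S] 1(3) by blast
  have *: "(f t + g t) * (q2 t * b t) = p1 t * a t + p2 t * b t"
    if "q1 t * a t = q2 t * b t" "f t * q1 t = p1 t" "g t * q2 t = p2 t" for t
  proof -
    have "(f t + g t) * (q2 t * b t) = f t * (q1 t * a t) + g t * (q2 t * b t)"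
      by (simp only: distrib_right that(1))
    then show ?thesis
      by (simp only: that(2,3) [symmetric] mult.assoc)
  qed
  have mono: "poly_fun S (max n1 n2 + m) h" if "poly_fun S (n1 + m) h \<or> poly_fun S (n2 + m) h" for h
    using that poly_fun_mono [of S "n1 + m" h "max n1 n2 + m" S]
      poly_fun_mono [of S "n2 + m" h "max n1 n2 + m" S] division_subringD(1) [OF S] by auto
  show ?thesis
  proof (rule regularI [OF S])
    show "poly_fun S (max n1 n2 + m) (\<lambda>t. p1 t * a t + p2 t * b t)"
      using poly_fun_mult [OF S 1(1) ab(1)] poly_fun_mult [OF S 2(1) ab(2)]
      by (intro poly_fun_add S mono) auto
    show "poly_fun S (n2 + m) (\<lambda>t. q2 t * b t)"
      by (intro poly_fun_mult S 2 ab)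
    show "(f 0 + g 0) * (q2 0 * b 0) = p1 0 * a 0 + p2 0 * b 0"
      using * [of 0] ab(4) zero_center 1(4) 2(4) by blast
    show "\<forall>\<^sub>F t in generic. (f t + g t) * (q2 t * b t) = p1 t * a t + p2 t * b t"
      using 1(5) 2(5) eventually_generic_center
      by eventually_elim (use ab(4) * in blast)
  qed (use ab(3) 2(3) in simp)
qed

lemma regular_diff:
  fixes f g :: "'a \<Rightarrow> 'a"
  assumes S: "division_subring S" and f: "regular S f" and g: "regular S g"
  shows "regular S (\<lambda>t. f t - g t)"
proof -
  have "regular S (\<lambda>t. f t + - 1 * g t)"
    using assms by (intro regular_add regular_mult regular_const) (auto intro: division_subringD [OF S])
  then show ?thesis
    by simp
qed

lemma regular_inverse:
  fixes f :: "'a \<Rightarrow> 'a"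
  assumes S: "division_subring S" and f: "regular S f" and "f 0 \<noteq> 0"
  shows "regular S (\<lambda>t. inverse (f t))"
proof -
  obtain n p q where pq: "poly_fun S n p" "poly_fun S n q" "q 0 \<noteq> 0" "f 0 * q 0 = p 0"
     "\<forall>\<^sub>F t in generic. f t * q t = p t"
    using f unfolding regular_def by blast
  have *: "inverse (f t) * p t = q t" if "f t \<noteq> 0" "f t * q t = p t" for t
    using that by (simp add: that(2) [symmetric] mult.assoc [symmetric])
  show ?thesis
  proof (rule regularI [OF S pq(2,1)])
    show "p 0 \<noteq> 0"
      using assms(3) pq(3,4) by (metis no_zero_divisors)
    show "inverse (f 0) * p 0 = q 0"
      using assms(3) pq(4) * by blast
    show "\<forall>\<^sub>F t in generic. inverse (f t) * p t = q t"
      using regular_generic_nonzero [OF f assms(3)] pq(5) by eventually_elim (rule *)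
  qed
qed

subsection \<open>Functions with values in a division subring\<close>

text \<open>A left \<open>K\<close>-linear retraction of \<open>D\<close> onto \<open>K\<close>. Its kernel is a \<open>K\<close>-subspace \<open>H\<close> that is maximal
  among those not containing \<open>1\<close>.\<close>

lemma left_functional:
  fixes K :: "'b::division_ring set"
  assumes K: "division_subring K"
  shows "\<exists>\<phi>. (\<forall>x y. \<phi> (x + y) = \<phi> x + \<phi> y) \<and> (\<forall>k\<in>K. \<forall>x. \<phi> (k * x) = k * \<phi> x)
    \<and> (\<forall>x. \<phi> x \<in> K) \<and> \<phi> 1 = 1"
proof -
  note KD = division_subringD [OF K]
  define A where "A = {H. (0::'b) \<in> H \<and> (\<forall>x\<in>H. \<forall>y\<in>H. x + y \<in> H) \<and> (\<forall>k\<in>K. \<forall>x\<in>H. k * x \<in> H) \<and> 1 \<notin> H}"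
  have "{0} \<in> A"
    by (auto simp: A_def)
  moreover have "\<Union>C \<in> A" if "C \<noteq> {}" "subset.chain A C" for C
  proof -
    have C: "C \<subseteq> A" "\<forall>X\<in>C. \<forall>Y\<in>C. X \<subseteq> Y \<or> Y \<subseteq> X"
      using that(2) by (auto simp: subset.chain_def)
    have "x + y \<in> \<Union>C" if "x \<in> X" "X \<in> C" "y \<in> Y" "Y \<in> C" for x y X Y
    proof -
      have "\<exists>Z\<in>C. x \<in> Z \<and> y \<in> Z"
        using C(2) that by blast
      then show ?thesis
        using C(1) unfolding A_def by blast
    qed
    moreover have "0 \<in> \<Union>C" "1 \<notin> \<Union>C" "\<forall>k\<in>K. \<forall>x\<in>\<Union>C. k * x \<in> \<Union>C"
      using C(1) that(1) unfolding A_def by blast+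
    ultimately show ?thesis
      unfolding A_def by blast
  qed
  ultimately obtain H where "H \<in> A" and max: "\<And>X. X \<in> A \<Longrightarrow> H \<subseteq> X \<Longrightarrow> X = H"
    using subset_Zorn_nonempty [of A] by blast
  then have H: "0 \<in> H" "\<And>x y. x \<in> H \<Longrightarrow> y \<in> H \<Longrightarrow> x + y \<in> H"
      "\<And>k x. k \<in> K \<Longrightarrow> x \<in> H \<Longrightarrow> k * x \<in> H" "1 \<notin> H"
    by (auto simp: A_def)
  have ex: "\<exists>k\<in>K. d - k \<in> H" for d
  proof (cases "d \<in> H")
    case True
    then show ?thesis
      using KD(1) by force
  next
    case False
    \<comment> \<open>The subspace \<open>X = H + K d\<close> properly contains \<open>H\<close>, so it contains \<open>1\<close>.\<close>
    define X where "X = {h + k * d | h k. h \<in> H \<and> k \<in> K}"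
    have "H \<subseteq> X" "d \<in> X"
      using KD(1,2) H(1) unfolding X_def by force+
    then have "X \<notin> A"
      using max False by blast
    moreover have "0 \<in> X"
      using \<open>H \<subseteq> X\<close> H(1) by blast
    moreover have "x + y \<in> X" if xy: "x \<in> X" "y \<in> X" for x y
    proof -
      obtain h k h' k' where "x = h + k * d" "y = h' + k' * d" "h \<in> H" "k \<in> K" "h' \<in> H" "k' \<in> K"
        using xy unfolding X_def by blast
      moreover from this have "x + y = (h + h') + (k + k') * d"
        by (simp add: algebra_simps)
      ultimately show ?thesis
        unfolding X_def using H(2) KD(7) by blast
    qed
    moreover have "c * x \<in> X" if cx: "c \<in> K" "x \<in> X" for c x
    proof -
      obtain h k where "x = h + k * d" "h \<in> H" "k \<in> K"
        using cx unfolding X_def by blast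
      moreover from this have "c * x = c * h + (c * k) * d"
        by (simp add: algebra_simps)
      ultimately show ?thesis
        unfolding X_def using H(3) KD(4) cx(1) by blast
    qed
    ultimately have "1 \<in> X"
      unfolding A_def by blast
    then obtain h k where hk: "1 = h + k * d" "h \<in> H" "k \<in> K"
      unfolding X_def by blast
    then have "k \<noteq> 0"
      using H(4) by auto
    have "inverse k = inverse k * (h + k * d)"
      using hk(1) by simp
    also have "\<dots> = inverse k * h + d"
      using \<open>k \<noteq> 0\<close> by (simp add: distrib_left mult.assoc [symmetric])
    finally have "d - inverse k = - inverse k * h"
      by (simp add: algebra_simps)
    moreover have "- inverse k * h \<in> H"
      by (intro H(3) KD hk)
    ultimately show ?thesis
      using KD(5) [OF hk(3)] by metis
  qed
  have zero: "k = 0" if "k \<in> K" "k \<in> H" for k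
  proof (rule ccontr)
    assume "k \<noteq> 0"
    then have "inverse k * k = 1"
      by simp
    then show False
      using H(3) [OF KD(5) [OF that(1)] that(2)] H(4) by simp
  qed
  define \<phi> where "\<phi> = (\<lambda>d. SOME k. k \<in> K \<and> d - k \<in> H)"
  have \<phi>: "\<phi> d \<in> K" "d - \<phi> d \<in> H" for d
    using someI_ex [of "\<lambda>k. k \<in> K \<and> d - k \<in> H"] ex [of d] by (auto simp: \<phi>_def)
  have minus: "- x \<in> H" if "x \<in> H" for x
    using H(3) [OF KD(6) [OF KD(2)] that] by simp
  have uniq: "\<phi> d = k" if "k \<in> K" "d - k \<in> H" for d k
  proof -
    have "(d - k) + - (d - \<phi> d) \<in> H"
      by (intro H(2) minus that \<phi>)
    then have "\<phi> d - k = 0"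
      using zero [of "\<phi> d - k"] KD(3) [OF \<phi>(1) that(1)] by simp
    then show ?thesis
      by simp
  qed
  have "\<phi> (x + y) = \<phi> x + \<phi> y" for x y
    using H(2) [OF \<phi>(2) [of x] \<phi>(2) [of y]]
    by (intro uniq KD(7) \<phi>) (simp add: algebra_simps)
  moreover have "\<phi> (k * x) = k * \<phi> x" if "k \<in> K" for k x
    using H(3) [OF that \<phi>(2) [of x]]
    by (intro uniq KD(4) \<phi> that) (simp add: right_diff_distrib)
  moreover have "\<phi> 1 = 1"
    by (intro uniq KD) (simp add: H)
  ultimately show ?thesis
    using \<phi>(1) by blast
qed

text \<open>Write \<open>f = p q\<^sup>-\<^sup>1\<close>. A left \<open>K\<close>-linear functional \<open>\<psi>\<close> with \<open>\<psi> (q 0) = 1\<close>, applied to \<open>f t * q t = p t\<close>,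
  gives \<open>f t * \<psi> (q t) = \<psi> (p t)\<close> whenever \<open>f t \<in> K\<close>. For \<open>t \<in> K \<inter> F\<close> both \<open>\<psi> (p t)\<close> and
  \<open>\<psi> (q t)\<close> are polynomials \<open>P\<close> and \<open>Q\<close> over \<open>K\<close>, so \<open>f 0 = P 0\<close>.\<close>

lemma regular_value_mem:
  fixes f :: "'a \<Rightarrow> 'a"
  assumes K: "division_subring K" and infK: "infinite (K \<inter> ring_center)"
    and f: "regular UNIV f" and val: "\<forall>\<^sub>F t in generic. t \<in> K \<longrightarrow> f t \<in> K"
  shows "f 0 \<in> K"
proof -
  note KD = division_subringD [OF K]
  obtain n p q where pq: "poly_fun UNIV n p" "poly_fun UNIV n q" "q 0 \<noteq> 0" "f 0 * q 0 = p 0"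
     "\<forall>\<^sub>F t in generic. f t * q t = p t"
    using f unfolding regular_def by blast
  obtain \<phi> where \<phi>: "\<And>x y. \<phi> (x + y) = \<phi> x + \<phi> y" "\<And>k x. k \<in> K \<Longrightarrow> \<phi> (k * x) = k * \<phi> x"
      "\<And>x. \<phi> x \<in> K" "\<phi> 1 = 1"
    using left_functional [OF K] by metis
  define \<psi> where "\<psi> = (\<lambda>x. \<phi> (x * inverse (q 0)))"
  have \<psi>: "\<psi> (x + y) = \<psi> x + \<psi> y" "k \<in> K \<Longrightarrow> \<psi> (k * x) = k * \<psi> x" "\<psi> x \<in> K" for x y k
    by (auto simp: \<psi>_def \<phi> distrib_right mult.assoc)
  have \<psi>1: "\<psi> (q 0) = 1"
    using pq(3) \<phi>(4) by (simp add: \<psi>_def)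
  have ex: "\<exists>H. poly_fun K n H \<and> (\<forall>t\<in>K \<inter> ring_center. H t = \<psi> (h t))"
    if h: "poly_fun UNIV n h" for h
  proof -
    obtain a where a: "\<forall>t\<in>ring_center. h t = (\<Sum>i<n. a i * t ^ i)"
      using h unfolding poly_fun_def by blast
    have "\<psi> 0 = 0"
      using \<psi>(1) [of 0 0] by simp
    then have sum: "\<psi> (\<Sum>i\<in>I. c i) = (\<Sum>i\<in>I. \<psi> (c i))" for I and c :: "nat \<Rightarrow> 'a"
      by (induction I rule: infinite_finite_induct) (auto simp: \<psi>)
    have "\<psi> (h t) = (\<Sum>i<n. \<psi> (a i) * t ^ i)" if "t \<in> K \<inter> ring_center" for t
    proof -
      have "\<psi> (a i * t ^ i) = \<psi> (a i) * t ^ i" for i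
        using that centerD [OF center_power, of t i "a i"] centerD [OF center_power, of t i "\<psi> (a i)"]
          \<psi>(2) [OF division_subring_power [OF K], of t i "a i"] by simp
      then show ?thesis
        using a that sum by simp
    qed
    moreover have "poly_fun K n (\<lambda>t. \<Sum>i<n. \<psi> (a i) * t ^ i)"
      unfolding poly_fun_def using \<psi>(3) by (intro exI [of _ "\<lambda>i. \<psi> (a i)"]) auto
    ultimately show ?thesis
      by (intro exI [of _ "\<lambda>t. \<Sum>i<n. \<psi> (a i) * t ^ i"]) auto
  qed
  obtain P where P: "poly_fun K n P" "\<And>t. t \<in> K \<inter> ring_center \<Longrightarrow> P t = \<psi> (p t)"
    using ex [OF pq(1)] by blast
  obtain Q where Q: "poly_fun K n Q" "\<And>t. t \<in> K \<inter> ring_center \<Longrightarrow> Q t = \<psi> (q t)"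
    using ex [OF pq(2)] by blast
  have reg: "regular UNIV (\<lambda>t. f t * Q t - P t)"
    by (intro regular_diff regular_mult f division_subring_UNIV
        regular_mono [OF regular_poly_fun [OF K P(1)]] regular_mono [OF regular_poly_fun [OF K Q(1)]])
  have "\<forall>\<^sub>F t in generic. t \<in> K \<longrightarrow> f t * Q t - P t = 0"
    using val pq(5) eventually_generic_center
  proof eventually_elim
    case (elim t)
    then show ?case
      using P(2) [of t] Q(2) [of t] \<psi>(2) [of "f t" "q t"] by auto
  qed
  then have "infinite {t \<in> K \<inter> ring_center. t \<in> K \<longrightarrow> f t * Q t - P t = 0}"
    by (rule eventually_generic_infinite [OF _ infK]) simp
  moreover have "{t \<in> K \<inter> ring_center. t \<in> K \<longrightarrow> f t * Q t - P t = 0}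
      \<subseteq> {t \<in> ring_center. f t * Q t - P t = 0}"
    by auto
  ultimately have "infinite {t \<in> ring_center. f t * Q t - P t = 0}"
    using finite_subset by blast
  then have "f 0 * Q 0 - P 0 = 0"
    by (rule regular_zeros(1) [OF reg])
  moreover have "0 \<in> K \<inter> ring_center"
    using zero_center KD(1) by simp
  then have "Q 0 = 1" "P 0 \<in> K"
    using P(2) Q(2) \<psi>1 \<psi>(3) by simp_all
  ultimately show ?thesis
    by simp
qed

text \<open>A nonzero central element that is a root of a nonzero polynomial over \<open>K\<close> is a root of a nonzero
  polynomial over the center of \<open>K\<close>, of no larger degree. For a relation with constant term \<open>1\<close>,
  the commutator with any \<open>c \<in> K\<close> is divisible by \<open>t\<close> and so gives a relation of smaller degree;
  if all these are trivial, the coefficients are central in \<open>K\<close>.\<close>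

lemma poly_fun_root_center:
  fixes t :: 'a
  assumes K: "division_subring K" and t: "t \<in> ring_center" "t \<noteq> 0"
    and "poly_fun K n u" "u t = 0" "s \<in> ring_center" "u s \<noteq> 0"
  shows "\<exists>v. poly_fun (K \<inter> centralizer K) n v \<and> v t = 0 \<and> (\<exists>s\<in>ring_center. v s \<noteq> 0)"
  using assms(4-)
proof (induction n arbitrary: u s)
  case 0
  then show ?case
    by (simp add: poly_fun_0)
next
  case (Suc n)
  note KD = division_subringD [OF K]
  have Z0: "0 \<in> K \<inter> centralizer K"
    using KD(1) by (simp add: centralizer_def)
  obtain a u' where u: "a \<in> K" "poly_fun K n u'" "\<And>x. x \<in> ring_center \<Longrightarrow> u x = a + x * u' x"
    using Suc.prems(1) unfolding poly_fun_Suc by blast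
  have lift: ?case if "poly_fun K n w" "w t = 0" "x \<in> ring_center" "w x \<noteq> 0" for w x
    using Suc.IH [OF that] poly_fun_mono [of "K \<inter> centralizer K" n _ "Suc n" "K \<inter> centralizer K"] Z0
    by (meson le_Suc_eq order_refl)
  show ?case
  proof (cases "a = 0")
    case True
    then have "u' t = 0" "u' s \<noteq> 0"
      using u(3) [OF t(1)] u(3) [OF Suc.prems(3)] Suc.prems t by auto
    then show ?thesis
      using lift u(2) Suc.prems by blast
  next
    case False
    define w where "w = (\<lambda>x. inverse a * u' x)"
    have w: "poly_fun K n w"
      unfolding w_def by (rule poly_fun_cmult(1) [OF K u(2) KD(5) [OF u(1)]])
    have "inverse a * (a + t * u' t) = 1 + t * w t"
      using False centerD [OF t(1), of "inverse a"]
      by (simp add: w_def distrib_left mult.assoc [symmetric])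
    then have wt: "1 + t * w t = 0"
      using u(3) [OF t(1)] Suc.prems(2) by simp
    show ?thesis
    proof (cases "\<exists>c\<in>K. \<exists>x\<in>ring_center. c * w x - w x * c \<noteq> 0")
      case True
      then obtain c x where c: "c \<in> K" "x \<in> ring_center" "c * w x - w x * c \<noteq> 0"
        by blast
      have "t * (c * w t - w t * c) = c * (t * w t) - (t * w t) * c"
        using centerD [OF t(1), of c] by (simp add: right_diff_distrib mult.assoc [symmetric])
      also have "t * w t = - 1"
        using wt by (simp add: add_eq_0_iff)
      finally have "c * w t - w t * c = 0"
        using t by simp
      moreover have "poly_fun K n (\<lambda>x. c * w x - w x * c)"
        by (intro poly_fun_diff poly_fun_cmult K w c)
      ultimately show ?thesis
        using lift c by blast
    next
      case False
      then have comm: "c * w x = w x * c" if "c \<in> K" "x \<in> ring_center" for c x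
        using that by auto
      have coeffs: "poly_fun (K \<inter> centralizer K) m v"
        if "poly_fun K m v" "\<And>c x. c \<in> K \<Longrightarrow> x \<in> ring_center \<Longrightarrow> c * v x = v x * c" for m v
        using that
      proof (induction m arbitrary: v)
        case 0
        then show ?case by (simp add: poly_fun_0)
      next
        case (Suc m)
        obtain b v' where v: "b \<in> K" "poly_fun K m v'" "\<And>x. x \<in> ring_center \<Longrightarrow> v x = b + x * v' x"
          using Suc.prems(1) unfolding poly_fun_Suc by blast
        have "v 0 = b"
          using v(3) [OF zero_center] by simp
        then have b: "c * b = b * c" if "c \<in> K" for c
          using Suc.prems(2) [OF that zero_center] by simp
        have "c * v' x - v' x * c = 0" if c: "c \<in> K" and x: "x \<in> ring_center" for c x
        proof -
          have nz: "c * v' y - v' y * c = 0" if y: "y \<in> ring_center" "y \<noteq> 0" for y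
          proof -
            have "y * (c * v' y - v' y * c) = c * (y * v' y) - (y * v' y) * c"
              using centerD [OF y(1), of c] by (simp add: right_diff_distrib mult.assoc [symmetric])
            also have "\<dots> = 0"
              using Suc.prems(2) [OF c y(1)] b [OF c] by (simp add: v(3) [OF y(1)] algebra_simps)
            finally show ?thesis
              using y by simp
          qed
          have "\<forall>\<^sub>F y in generic. c * v' y - v' y * c = 0"
            using eventually_generic_center eventually_generic_nonzero
            by eventually_elim (rule nz)
          moreover have "poly_fun K m (\<lambda>x. c * v' x - v' x * c)"
            by (intro poly_fun_diff poly_fun_cmult K v c)
          then have "poly_fun UNIV m (\<lambda>x. c * v' x - v' x * c)"
            by (rule poly_fun_mono) auto
          ultimately show ?thesis
            using poly_fun_generic_zeros x by blast
        qed
        then have "poly_fun (K \<inter> centralizer K) m v'"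
          by (intro Suc.IH v) auto
        moreover have "b \<in> K \<inter> centralizer K"
          using v(1) b by (auto simp: centralizer_def)
        ultimately show ?case
          unfolding poly_fun_Suc using v(3) by blast
      qed
      have "poly_fun K (Suc n) (\<lambda>x. 1 + x * w x)"
        unfolding poly_fun_Suc using KD(2) w by blast
      then have "poly_fun (K \<inter> centralizer K) (Suc n) (\<lambda>x. 1 + x * w x)"
      proof (rule coeffs)
        fix c x :: 'a
        assume c: "c \<in> K" "x \<in> ring_center"
        have "c * (x * w x) = (x * w x) * c"
          using comm [OF c] centerD [OF c(2), of c]
          by (metis mult.assoc)
        then show "c * (1 + x * w x) = (1 + x * w x) * c"
          by (simp add: distrib_left distrib_right)
      qed
      then show ?thesis
        using wt zero_center by (intro exI [of _ "\<lambda>x. 1 + x * w x"]) force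
    qed
  qed
qed

lemma finite_algebraic:
  assumes "finite Z"
  shows "finite {t \<in> ring_center. \<exists>v. poly_fun Z n v \<and> v t = 0 \<and> (\<exists>s\<in>ring_center. v s \<noteq> (0::'a))}"
proof -
  define ev where "ev = (\<lambda>a (t::'a). \<Sum>i<n. a i * t ^ i)"
  define A where "A = {a \<in> PiE {..<n} (\<lambda>_. Z). \<exists>s\<in>ring_center. ev a s \<noteq> 0}"
  have "finite A"
    unfolding A_def using finite_PiE [of "{..<n}" "\<lambda>_. Z"] assms by simp
  moreover have "finite {t \<in> ring_center. ev a t = 0}" if "a \<in> A" for a
  proof -
    have "poly_fun UNIV n (ev a)"
      unfolding poly_fun_def ev_def by blast
    then show ?thesis
      using that poly_fun_zeros [of n "ev a"] unfolding A_def by blast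
  qed
  ultimately have "finite (\<Union>a\<in>A. {t \<in> ring_center. ev a t = 0})"
    by blast
  moreover have "{t \<in> ring_center. \<exists>v. poly_fun Z n v \<and> v t = 0 \<and> (\<exists>s\<in>ring_center. v s \<noteq> 0)}
      \<subseteq> (\<Union>a\<in>A. {t \<in> ring_center. ev a t = 0})"
  proof
    fix t
    assume "t \<in> {t \<in> ring_center. \<exists>v. poly_fun Z n v \<and> v t = 0 \<and> (\<exists>s\<in>ring_center. v s \<noteq> 0)}"
    then obtain v s where v: "poly_fun Z n v" "t \<in> ring_center" "v t = 0" "s \<in> ring_center" "v s \<noteq> 0"
      by blast
    then obtain a where a: "\<forall>i<n. a i \<in> Z" "\<forall>t\<in>ring_center. v t = (\<Sum>i<n. a i * t ^ i)"
      unfolding poly_fun_def by blast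
    have "ev (restrict a {..<n}) x = v x" if "x \<in> ring_center" for x
      using a that by (simp add: ev_def)
    moreover have "restrict a {..<n} \<in> PiE {..<n} (\<lambda>_. Z)"
      using a(1) by auto
    ultimately show "t \<in> (\<Union>a\<in>A. {t \<in> ring_center. ev a t = 0})"
      unfolding A_def using v by (intro UN_I [of "restrict a {..<n}"]) auto
  qed
  ultimately show ?thesis
    using finite_subset by blast
qed

text \<open>If \<open>f = p q\<^sup>-\<^sup>1\<close> and \<open>f t \<in> K\<close>, then \<open>t\<close> is a root of the polynomial
  \<open>f t * q - p\<close> over \<open>K\<close>, with \<open>f t\<close> taken as a constant. As the center of \<open>K\<close> is finite, only finitely many \<open>t\<close> are algebraic of
  bounded degree; for the others this polynomial is zero, and its constant term shows \<open>f t = f 0\<close>.\<close>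

lemma regular_generic_constant:
  fixes f :: "'a \<Rightarrow> 'a"
  assumes K: "division_subring K" and fin: "finite (K \<inter> centralizer K)"
    and f: "regular K f" and val: "\<forall>\<^sub>F t in generic. f t \<in> K"
  shows "\<forall>\<^sub>F t in generic. f t = f 0"
proof -
  obtain n p q where pq: "poly_fun K n p" "poly_fun K n q" "q 0 \<noteq> 0" "f 0 * q 0 = p 0"
     "\<forall>\<^sub>F t in generic. f t * q t = p t"
    using f unfolding regular_def by blast
  have "\<forall>\<^sub>F t in generic. \<not> (\<exists>v. poly_fun (K \<inter> centralizer K) n v \<and> v t = 0 \<and> (\<exists>s\<in>ring_center. v s \<noteq> 0))"
    unfolding eventually_generic not_not by (rule finite_algebraic [OF fin])
  then show ?thesis
    using val pq(5) eventually_generic_center eventually_generic_nonzero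
  proof eventually_elim
    case (elim t)
    have "poly_fun K n (\<lambda>s. f t * q s - p s)"
      by (intro poly_fun_diff poly_fun_cmult K pq elim)
    then have "f t * q 0 - p 0 = 0"
      using poly_fun_root_center [OF K, of t n "\<lambda>s. f t * q s - p s" 0] elim zero_center by auto
    then have "f t * q 0 = f 0 * q 0"
      using pq(4) by simp
    then show ?case
      using pq(3) by simp
  qed
qed

subsection \<open>Iterated commutators\<close>

lemma regular_om:
  assumes S: "division_subring S" and g: "g \<noteq> 0" "\<And>x. x \<in> S \<Longrightarrow> cj g x \<in> S"
    and "a \<in> S" "b \<in> S" "(a :: 'a) \<noteq> 0"
  shows "regular S (\<lambda>t. (om g ^^ i) (a + t * b))"
proof (induction i)
  case 0
  then show ?case
    using regular_linear assms by simp
next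
  case (Suc i)
  have "cj g ((om g ^^ i) a) \<noteq> 0"
    using om_funpow_nz assms by (simp add: cj_eq_0_iff)
  then have "regular S (\<lambda>t. (om g ^^ i) (a + t * b) * inverse (cj g ((om g ^^ i) (a + t * b))))"
    using Suc g by (intro regular_mult S regular_inverse regular_cj) auto
  then show ?case
    unfolding om_def [symmetric] by simp
qed

text \<open>The expansion \<open>\<omega>\<^sup>i (1 + t y) = 1 + t \<delta>\<^sup>i y + \<dots>\<close>: if \<open>w = 1 + t h\<close>, then
  \<open>\<omega> w = 1 + (w - \<sigma> w) (\<sigma> w)\<^sup>-\<^sup>1 = 1 + t (h - \<sigma> h) (\<sigma> w)\<^sup>-\<^sup>1\<close>.\<close>

lemma om_first_order:
  assumes S: "division_subring S" and g: "g \<noteq> 0" "\<And>x. x \<in> S \<Longrightarrow> cj g x \<in> S" and y: "(y :: 'a) \<in> S"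
  shows "\<exists>h. regular S h \<and> h 0 = (dl g ^^ i) y \<and>
    (\<forall>\<^sub>F t in generic. (om g ^^ i) (1 + t * y) = 1 + t * h t)"
proof (induction i)
  case 0
  then show ?case
    using regular_const [OF S y] by auto
next
  case (Suc i)
  then obtain h where h: "regular S h" "h 0 = (dl g ^^ i) y"
      "\<forall>\<^sub>F t in generic. (om g ^^ i) (1 + t * y) = 1 + t * h t"
    by blast
  define w where "w = (\<lambda>t. (om g ^^ i) (1 + t * y))"
  have w: "regular S w"
    unfolding w_def using division_subringD(2) [OF S] by (intro regular_om S g y) auto
  have w0: "w 0 = 1"
  proof -
    have "om g 1 = 1"
      using g by (simp add: om_def cj_1)
    then show ?thesis
      unfolding w_def by (induction i) simp_all
  qed
  have wnz: "\<forall>\<^sub>F t in generic. w t \<noteq> 0"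
    using w0 by (intro regular_generic_nonzero [OF w]) simp
  define h' where "h' = (\<lambda>t. (h t - cj g (h t)) * inverse (cj g (w t)))"
  have "regular S h'"
    unfolding h'_def using w0 g
    by (intro regular_mult regular_diff regular_inverse regular_cj S h w) (auto simp: cj_1)
  moreover have "h' 0 = (dl g ^^ Suc i) y"
    using h(2) w0 g by (simp add: h'_def dl_def cj_1)
  moreover have "\<forall>\<^sub>F t in generic. (om g ^^ Suc i) (1 + t * y) = 1 + t * h' t"
    using wnz h(3) eventually_generic_center
  proof eventually_elim
    case (elim t)
    then have "w t \<noteq> 0" and wt: "w t = 1 + t * h t" and t: "cj g t = t"
      using g by (auto simp: w_def cj_eq_iff centerD)
    then have nz: "cj g (w t) \<noteq> 0"
      using g by (simp add: cj_eq_0_iff)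
    have "w t - cj g (w t) = t * (h t - cj g (h t))"
      using g t by (simp add: wt cj_add cj_mult cj_1 right_diff_distrib)
    then have "(w t - cj g (w t)) * inverse (cj g (w t)) = t * h' t"
      by (simp add: h'_def mult.assoc)
    then have "om g (w t) = 1 + t * h' t"
      using nz by (simp add: om_def left_diff_distrib algebra_simps)
    then show ?case
      by (simp add: w_def)
  qed
  ultimately show ?case
    by blast
qed

end

section \<open>Subnormal subgroups\<close>

text \<open>Subgroups of \<open>D\<^sup>*\<close> as sets, without a group record.\<close>

definition mult_subgroup :: "'a::division_ring set \<Rightarrow> bool" where
  "mult_subgroup H \<longleftrightarrow> 0 \<notin> H \<and> 1 \<in> H \<and> (\<forall>x\<in>H. \<forall>y\<in>H. x * y \<in> H) \<and> (\<forall>x\<in>H. inverse x \<in> H)"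

text \<open>Normality for sets that are known to be subgroups of \<open>D\<^sup>*\<close>.\<close>

definition normal_in :: "'a::division_ring set \<Rightarrow> 'a set \<Rightarrow> bool" where
  "normal_in H G \<longleftrightarrow> H \<subseteq> G \<and> (\<forall>g\<in>G. \<forall>h\<in>H. cj g h \<in> H)"

text \<open>\<open>subnormal r H\<close>: there is a series of \<open>r\<close> normal steps from \<open>D\<^sup>*\<close> down to \<open>H\<close>.\<close>

primrec subnormal :: "nat \<Rightarrow> 'a::division_ring set \<Rightarrow> bool" where
  "subnormal 0 H \<longleftrightarrow> H = - {0}"
| "subnormal (Suc r) H \<longleftrightarrow> mult_subgroup H \<and> (\<exists>G. subnormal r G \<and> normal_in H G)"

lemma mult_subgroup_nonzero: "mult_subgroup (- {0})"
  by (auto simp: mult_subgroup_def)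

lemma subnormal_mult_subgroup: "subnormal r H \<Longrightarrow> mult_subgroup H"
  by (cases r) (auto simp: mult_subgroup_nonzero)

lemma mult_subgroupD:
  assumes "mult_subgroup H"
  shows "x \<in> H \<Longrightarrow> x \<noteq> 0" "1 \<in> H" "x \<in> H \<Longrightarrow> y \<in> H \<Longrightarrow> x * y \<in> H" "x \<in> H \<Longrightarrow> inverse x \<in> H"
  using assms by (auto simp: mult_subgroup_def)

text \<open>If \<open>H\<close> is normal in \<open>G\<close>, then \<open>\<omega> p = (p g p\<^sup>-\<^sup>1) g\<^sup>-\<^sup>1 \<in> H\<close> for \<open>p \<in> G\<close>.\<close>

lemma om_funpow_subnormal:
  assumes "subnormal r H" "g \<in> H" "x \<noteq> 0"
  shows "(om g ^^ r) x \<in> H"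
  using assms(1,2)
proof (induction r arbitrary: H)
  case 0
  then show ?case
    using assms(3) by simp
next
  case (Suc r)
  then obtain G where H: "mult_subgroup H" and G: "subnormal r G" "normal_in H G"
    by auto
  define p where "p = (om g ^^ r) x"
  have g: "g \<in> G" "g \<noteq> 0"
    using Suc.prems(2) G(2) mult_subgroupD(1) [OF H] by (auto simp: normal_in_def)
  then have "p \<in> G"
    unfolding p_def by (intro Suc.IH G)
  then have p: "cj p g \<in> H" "p \<noteq> 0"
    using G(2) Suc.prems(2) mult_subgroupD(1) [OF subnormal_mult_subgroup [OF G(1)]]
    by (auto simp: normal_in_def)
  have "om g p = cj p g * inverse g"
    using g p by (simp add: om_def cj_def nonzero_inverse_mult_distrib mult.assoc)
  also have "\<dots> \<in> H"
    by (intro mult_subgroupD [OF H] p Suc.prems)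
  finally show ?case
    by (simp add: p_def)
qed

lemma cj_inject: "g \<noteq> 0 \<Longrightarrow> cj g x = cj g y \<longleftrightarrow> x = y"
  using cj_eq_0_iff [of g "x - y"] by (simp add: cj_diff)

lemma cj_cj_inverse: "g \<noteq> 0 \<Longrightarrow> cj g (cj (inverse g) x) = x"
  by (simp add: cj_def mult.assoc [symmetric]) (simp add: mult.assoc)

lemma centralizer_cj:
  assumes "g \<noteq> 0" "\<And>k. k \<in> S \<Longrightarrow> cj (inverse g) k \<in> S" "a \<in> centralizer S"
  shows "cj g a \<in> centralizer S"
proof -
  have "cj g a * s = s * cj g a" if "s \<in> S" for s
  proof -
    have "a * cj (inverse g) s = cj (inverse g) s * a"
      using assms(2) [OF that] assms(3) by (simp add: centralizer_def)
    then have "cj g (a * cj (inverse g) s) = cj g (cj (inverse g) s * a)"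
      by simp
    then show ?thesis
      using assms(1) by (simp add: cj_mult cj_cj_inverse)
  qed
  then show ?thesis
    by (simp add: centralizer_def)
qed

text \<open>In the chain \<open>c, \<delta> c, \<delta>\<^sup>2 c, \<dots>\<close>, which ends in zero, take the last two nonzero members: with \<open>u = \<delta>\<^sup>k c\<close> one has
  \<open>\<delta> u \<noteq> 0\<close> and \<open>\<delta> (\<delta> u) = 0\<close>.\<close>

lemma dl_nilpotent_witness:
  assumes "(dl g ^^ m) c = 0" "dl g c \<noteq> 0"
  shows "\<exists>k. (dl g ^^ Suc (Suc k)) c = 0 \<and> (dl g ^^ Suc k) c \<noteq> 0"
  using assms
proof (induction m)
  case (Suc m)
  show ?case
  proof (cases "(dl g ^^ m) c = 0")
    case False
    moreover from False obtain k where "m = Suc k"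
      using Suc.prems by (cases m) auto
    ultimately show ?thesis
      using Suc.prems by blast
  qed (use Suc in blast)
qed auto

text \<open>Comparison of the first-order terms at infinitely many \<open>t\<close>.\<close>

lemma dl_funpow_eq_0_from_om:
  assumes inf: "infinite T" "T \<subseteq> (ring_center :: 'a::division_ring set)" and "(g :: 'a) \<noteq> 0"
    and om: "\<And>t. t \<in> T \<Longrightarrow> 1 + t * y \<noteq> 0 \<Longrightarrow> (om g ^^ i) (1 + t * y) = 1"
  shows "(dl g ^^ i) y = 0"
proof -
  have infc: "infinite (ring_center :: 'a set)"
    using inf finite_subset by blast
  obtain h where h: "regular UNIV h" "h 0 = (dl g ^^ i) y"
      "\<forall>\<^sub>F t in generic. (om g ^^ i) (1 + t * y) = 1 + t * h t"
    using om_first_order [OF infc division_subring_UNIV assms(3)] by blast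
  have nz: "\<forall>\<^sub>F t in generic. 1 + t * y \<noteq> 0"
    using regular_generic_nonzero [OF infc regular_linear [OF division_subring_UNIV, of 1 y]] by simp
  have "\<forall>\<^sub>F t in generic. t \<in> T \<longrightarrow> h t = 0"
    using h(3) nz eventually_generic_nonzero
  proof eventually_elim
    case (elim t)
    then show ?case
      using om [of t] by auto
  qed
  then have "infinite {t \<in> T. t \<in> T \<longrightarrow> h t = 0}"
    by (rule eventually_generic_infinite [OF _ inf])
  moreover have "{t \<in> T. t \<in> T \<longrightarrow> h t = 0} \<subseteq> {t \<in> ring_center. h t = 0}"
    using inf(2) by auto
  ultimately have "infinite {t \<in> ring_center. h t = 0}"
    using finite_subset by blast
  then show ?thesis
    using regular_zeros(1) [OF infc h(1)] h(2) by simp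
qed

section \<open>Division subrings invariant under a subnormal subgroup\<close>

text \<open>The situation of the theorem for a proper division subring \<open>K\<close> with infinitely many central
  elements of \<open>D\<close>. The subgroup \<open>N\<close> may be central; \<open>K\<close> may be commutative.\<close>

locale stable_subring =
  fixes K N :: "'a::division_ring set" and r :: nat
  assumes K: "division_subring K" and infinite_K: "infinite (K \<inter> ring_center)"
    and proper: "K \<noteq> UNIV" and N: "subnormal r N"
    and stable: "\<And>g k. g \<in> N \<Longrightarrow> k \<in> K \<Longrightarrow> cj g k \<in> K"
begin

lemma infinite_center: "infinite (ring_center :: 'a set)"
  using infinite_K by (metis finite_Int)

lemmas KD = division_subringD [OF K]

lemmas ND = mult_subgroupD [OF subnormal_mult_subgroup [OF N]]

lemma dl_mem: "g \<in> N \<Longrightarrow> k \<in> K \<Longrightarrow> (dl g ^^ i) k \<in> K"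
  by (induction i) (auto simp: dl_def intro: KD stable)

lemma om_mem: "g \<in> N \<Longrightarrow> k \<in> K \<Longrightarrow> (om g ^^ i) k \<in> K"
  by (induction i) (auto simp: om_def intro: KD stable)

text \<open>Put \<open>w t = \<omega>\<^sup>r (1 + t y) = 1 + t h t\<close>. Since \<open>w t \<in> N\<close>, the element
  \<open>w c w\<^sup>-\<^sup>1 - c = t (h c - c h) w\<^sup>-\<^sup>1\<close> lies in \<open>K\<close> for generic \<open>t \<in> K \<inter> F\<close>; divide by \<open>t\<close> and pass to
  the value at \<open>0\<close>.\<close>

lemma lie_mem:
  assumes g: "g \<in> N" and c: "c \<in> K"
  shows "(dl g ^^ r) y * c - c * (dl g ^^ r) y \<in> K"
proof -
  note U = division_subring_UNIV and inf = infinite_center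
  have g0: "g \<noteq> 0"
    using ND(1) [OF g] .
  obtain h where h: "regular UNIV h" "h 0 = (dl g ^^ r) y"
      "\<forall>\<^sub>F t in generic. (om g ^^ r) (1 + t * y) = 1 + t * h t"
    using om_first_order [OF inf U g0] by blast
  define w where "w = (\<lambda>t. (om g ^^ r) (1 + t * y))"
  have w: "regular UNIV w"
    unfolding w_def by (rule regular_om [OF inf U g0]) auto
  have "om g 1 = 1"
    using g0 by (simp add: om_eq_1_iff)
  then have w0: "w 0 = 1"
    unfolding w_def by (induction r) simp_all
  define f where "f = (\<lambda>t. (h t * c - c * h t) * inverse (w t))"
  have f: "regular UNIV f"
    unfolding f_def using w0
    by (intro regular_mult [OF inf] regular_diff [OF inf] regular_inverse [OF inf] regular_const U h w) auto
  have nz: "\<forall>\<^sub>F t in generic. 1 + t * y \<noteq> 0"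
    using regular_generic_nonzero [OF inf regular_linear [OF U, of 1 y]] by simp
  have "\<forall>\<^sub>F t in generic. t \<in> K \<longrightarrow> f t \<in> K"
    using h(3) nz eventually_generic_nonzero eventually_generic_center
  proof eventually_elim
    case (elim t)
    show ?case
    proof
      assume t: "t \<in> K"
      have wN: "w t \<in> N"
        unfolding w_def by (rule om_funpow_subnormal [OF N g elim(2)])
      have wt: "w t = 1 + t * h t" "w t \<noteq> 0"
        using elim(1) ND(1) [OF wN] by (simp_all add: w_def)
      have "t * (h t * c - c * h t) = w t * c - c * w t"
        using centerD [OF elim(4), of c]
        by (simp add: wt(1) distrib_left distrib_right right_diff_distrib mult.assoc [symmetric])
      then have "t * f t = (w t * c - c * w t) * inverse (w t)"
        by (simp add: f_def mult.assoc [symmetric])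
      also have "\<dots> = cj (w t) c - c"
        using wt(2) by (simp add: cj_def left_diff_distrib mult.assoc)
      also have "\<dots> \<in> K"
        by (intro KD stable wN c)
      finally have "inverse t * (t * f t) \<in> K"
        by (rule KD(4) [OF KD(5) [OF t]])
      moreover have "inverse t * (t * f t) = f t"
        using elim(3) by (simp add: mult.assoc [symmetric])
      ultimately show "f t \<in> K"
        by simp
    qed
  qed
  then have "f 0 \<in> K"
    by (rule regular_value_mem [OF inf K infinite_K f])
  then show ?thesis
    using w0 h(2) by (simp add: f_def)
qed

text \<open>Take \<open>a \<notin> K\<close> with \<open>\<delta> a \<in> K\<close> in the image of \<open>\<delta>\<^sup>j\<close>, where \<open>\<delta>\<^sup>j\<^sup>+\<^sup>1\<close> maps \<open>D\<close> into \<open>K\<close>. By the twisted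
  Leibniz rule \<open>\<delta> (u v) = \<delta> u v + \<sigma> u \<delta> v\<close>, for \<open>b \<in> K\<close> the element \<open>\<delta>\<^sup>n (a b)\<close> is congruent to
  \<open>\<sigma>\<^sup>n a \<delta>\<^sup>n b\<close> modulo \<open>K\<close>. For \<open>n = j + 1\<close> this forces \<open>\<delta>\<^sup>n b = 0\<close>, so \<open>\<delta>\<^sup>n\<close> kills \<open>K\<close> and \<open>\<delta>\<^sup>2\<^sup>n = 0\<close>.\<close>

lemma dl_nilpotent_if_into:
  assumes g: "g \<in> N" and into: "\<And>y. (dl g ^^ j) y \<in> K"
  shows "\<exists>m. \<forall>y. (dl g ^^ m) y = 0"
proof -
  have g0: "g \<noteq> 0"
    using ND(1) [OF g] .
  have "\<exists>j a. (\<forall>y. (dl g ^^ Suc j) y \<in> K) \<and> (dl g ^^ j) a \<notin> K"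
    using into
  proof (induction j)
    case 0
    then show ?case
      using proper by auto
  next
    case (Suc j)
    then show ?case
      by blast
  qed
  then obtain j a0 where j: "\<And>y. (dl g ^^ Suc j) y \<in> K" and a0: "(dl g ^^ j) a0 \<notin> K"
    by blast
  define a where "a = (dl g ^^ j) a0"
  have da: "dl g a \<in> K"
    using j [of a0] by (simp add: a_def)
  have a: "(cj g ^^ n) a \<notin> K" "dl g ((cj g ^^ n) a) \<in> K" for n
  proof -
    have "(cj g ^^ n) a \<notin> K \<and> dl g ((cj g ^^ n) a) \<in> K"
    proof (induction n)
      case 0
      then show ?case
        using a0 da by (simp add: a_def)
    next
      case (Suc n)
      have eq: "cj g ((cj g ^^ n) a) = (cj g ^^ n) a - dl g ((cj g ^^ n) a)"
        by (simp add: dl_def)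
      have "cj g ((cj g ^^ n) a) \<notin> K"
      proof
        assume "cj g ((cj g ^^ n) a) \<in> K"
        then have "cj g ((cj g ^^ n) a) + dl g ((cj g ^^ n) a) \<in> K"
          using Suc KD(7) by blast
        then show False
          using Suc eq by simp
      qed
      moreover have "dl g (cj g ((cj g ^^ n) a)) = cj g (dl g ((cj g ^^ n) a))"
        by (simp add: dl_def cj_diff)
      ultimately show ?case
        using Suc stable [OF g] by simp
    qed
    then show "(cj g ^^ n) a \<notin> K" "dl g ((cj g ^^ n) a) \<in> K"
      by blast+
  qed
  have leibniz: "(dl g ^^ n) (a * b) - (cj g ^^ n) a * (dl g ^^ n) b \<in> K" if b: "b \<in> K" for n b
  proof (induction n)
    case 0
    then show ?case
      using KD(1) by simp
  next
    case (Suc n)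
    define u v where "u = (cj g ^^ n) a" and "v = (dl g ^^ n) b"
    define e where "e = (dl g ^^ n) (a * b) - u * v"
    have e: "e \<in> K"
      using Suc by (simp add: e_def u_def v_def)
    have "(dl g ^^ Suc n) (a * b) = dl g (e + u * v)"
      by (simp add: e_def)
    also have "\<dots> = dl g e + dl g u * v + cj g u * dl g v"
      using g0 by (simp add: dl_add) (simp add: dl_def cj_mult algebra_simps)
    finally have "(dl g ^^ Suc n) (a * b) - (cj g ^^ Suc n) a * (dl g ^^ Suc n) b
        = dl g e + dl g u * v"
      by (simp add: u_def v_def)
    moreover have "dl g e \<in> K" "dl g u \<in> K" "v \<in> K"
      using dl_mem [OF g e, of 1] a(2) dl_mem [OF g b] by (simp_all add: u_def v_def)
    ultimately show ?case
      using KD(4,7) by simp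
  qed
  have zero: "(dl g ^^ Suc j) b = 0" if b: "b \<in> K" for b
  proof (rule ccontr)
    define v where "v = (dl g ^^ Suc j) b"
    assume "(dl g ^^ Suc j) b \<noteq> 0"
    then have v: "v \<noteq> 0" "v \<in> K"
      using dl_mem [OF g b] by (simp_all only: v_def) simp
    have "(dl g ^^ Suc j) (a * b) - ((dl g ^^ Suc j) (a * b) - (cj g ^^ Suc j) a * v) \<in> K"
      unfolding v_def by (intro KD(3) j leibniz b)
    then have "(cj g ^^ Suc j) a * v \<in> K"
      by simp
    then have "(cj g ^^ Suc j) a * v * inverse v \<in> K"
      by (rule KD(4) [OF _ KD(5) [OF v(2)]])
    then show False
      using a(1) [of "Suc j"] v(1) by (simp add: mult.assoc)
  qed
  have "(dl g ^^ (Suc j + Suc j)) y = 0" for y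
    unfolding funpow_add o_apply by (rule zero [OF j])
  then show ?thesis
    by blast
qed

text \<open>If \<open>g\<close> does not commute with some \<open>c \<in> K\<close>, then Brauer's trick of comparing \<open>z = \<delta>\<^sup>r y\<close> with
  \<open>z g = \<delta>\<^sup>r (y g)\<close> shows that \<open>z (g c - c g) \<in> K\<close>, so \<open>\<delta>\<^sup>r\<close> maps \<open>D\<close> into \<open>K\<close>. Otherwise
  \<open>z g - g z \<in> K\<close> commutes with \<open>g\<close>.\<close>

lemma dl_nilpotent:
  assumes g: "g \<in> N" "g \<in> K"
  shows "\<exists>m. \<forall>y. (dl g ^^ m) y = 0"
proof (cases "\<exists>c\<in>K. g * c \<noteq> c * g")
  case True
  then obtain c where c: "c \<in> K" "g * c - c * g \<noteq> 0"
    by auto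
  have g0: "g \<noteq> 0"
    using ND(1) [OF g(1)] .
  have "(dl g ^^ r) y \<in> K" for y
  proof -
    define z e where "z = (dl g ^^ r) y" and "e = g * c - c * g"
    have e: "e \<in> K" "e \<noteq> 0"
      using c by (auto simp: e_def intro!: KD g)
    have zg: "(dl g ^^ r) (y * g) = z * g"
      using dl_mult_right [OF g0] by (simp add: z_def)
    have "z * g * c - c * (z * g) \<in> K" "z * c - c * z \<in> K"
      using lie_mem [OF g(1) c(1), of y] lie_mem [OF g(1) c(1), of "y * g"]
      unfolding zg z_def [symmetric] by auto
    then have "(z * g * c - c * (z * g)) - (z * c - c * z) * g \<in> K"
      by (rule KD(3) [OF _ KD(4) [OF _ g(2)]])
    also have "(z * g * c - c * (z * g)) - (z * c - c * z) * g = z * e"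
      by (simp add: e_def algebra_simps)
    finally have "z * e * inverse e \<in> K"
      by (rule KD(4) [OF _ KD(5) [OF e(1)]])
    then show ?thesis
      using e(2) by (simp add: mult.assoc z_def)
  qed
  then show ?thesis
    by (rule dl_nilpotent_if_into [OF g(1)])
next
  case False
  have g0: "g \<noteq> 0"
    using ND(1) [OF g(1)] .
  have "(dl g ^^ Suc (Suc r)) y = 0" for y
  proof -
    define z where "z = (dl g ^^ r) y"
    define u where "u = z * g - g * z"
    have "u \<in> K"
      using lie_mem [OF g, of y] by (simp add: u_def z_def)
    then have ug: "g * u = u * g"
      using False by blast
    have "dl g z = u * inverse g"
      using g0 by (simp add: dl_def cj_def u_def left_diff_distrib mult.assoc)
    moreover have "g * (u * inverse g) = u * inverse g * g"
      using g0 by (simp add: mult.assoc [symmetric] ug) (simp add: mult.assoc)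
    ultimately have "dl g (dl g z) = 0"
      using g0 by (simp add: dl_eq_0_iff)
    then show ?thesis
      by (simp add: z_def)
  qed
  then show ?thesis
    by blast
qed

text \<open>Inside the commutative set \<open>E\<close>, consider \<open>h = \<omega>\<^sup>r x \<in> N \<inter> K\<close> and \<open>k = \<omega> h\<close>. Then
  \<open>h g h\<^sup>-\<^sup>1 = k g\<close> and \<open>h\<close> commutes with \<open>k\<close>; as \<open>dl h\<close> is nilpotent, \<open>k = 1\<close>.
  Hence \<open>\<omega>\<^sup>r\<^sup>+\<^sup>1 x = 1\<close>, and nilpotence of \<open>\<delta>\<close> gives \<open>\<sigma> x = x\<close>.\<close>

lemma commute_if_nilpotent:
  assumes g: "g \<in> N" and nil: "\<And>y. (dl g ^^ m) y = 0"
    and E: "\<And>a b. a \<in> E \<Longrightarrow> b \<in> E \<Longrightarrow> a * b = b * a" "\<And>a b. a \<in> E \<Longrightarrow> b \<in> E \<Longrightarrow> a * b \<in> E"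
      "\<And>a. a \<in> E \<Longrightarrow> inverse a \<in> E" "\<And>a. a \<in> E \<Longrightarrow> cj g a \<in> E"
    and x: "x \<in> E" "x \<in> K" "x \<noteq> 0"
  shows "g * x = x * g"
proof -
  have g0: "g \<noteq> 0"
    using ND(1) [OF g] .
  define h where "h = (om g ^^ r) x"
  define k where "k = om g h"
  have h: "h \<in> N" "h \<in> K" "h \<noteq> 0"
    unfolding h_def using om_funpow_subnormal [OF N g x(3)] om_mem [OF g x(2)]
      om_funpow_nz [OF g0 x(3)] by auto
  have omE: "om g a \<in> E" if "a \<in> E" for a
    unfolding om_def by (intro E that)
  have hE: "h \<in> E"
    unfolding h_def by (induction r) (auto simp: x omE)
  then have "h * k = k * h"
    unfolding k_def by (intro E omE)
  then have k: "cj h k = k"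
    using h(3) by (simp add: cj_eq_iff)
  have "cj h g = k * g"
    using g0 h(3) by (simp add: k_def om_def cj_def nonzero_inverse_mult_distrib mult.assoc)
  moreover obtain m' where "\<And>y. (dl h ^^ m') y = 0"
    using dl_nilpotent [OF h(1,2)] by blast
  ultimately have "k = 1"
    using dl_eigen_nilpotent [OF h(3) _ k g0] by blast
  then have "(om g ^^ Suc r) x = 1"
    by (simp add: k_def h_def)
  then show ?thesis
    using om_nilpotent [OF g0 x(3)] nil by blast
qed

text \<open>If \<open>g\<close> did not commute with all of \<open>K\<close>, nilpotence of \<open>\<delta>\<close> would yield \<open>y \<in> K\<close> with
  \<open>\<sigma> y = y - 1\<close>. The double centralizer of \<open>y\<close> is commutative and \<open>\<sigma>\<close>-stable, so \<open>g\<close> commutes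
  with \<open>y\<close>, a contradiction.\<close>

lemma Int_commute:
  assumes g: "g \<in> N" "g \<in> K" and c: "c \<in> K"
  shows "g * c = c * g"
proof (rule ccontr)
  assume "g * c \<noteq> c * g"
  have g0: "g \<noteq> 0"
    using ND(1) [OF g(1)] .
  obtain m where m: "\<And>y. (dl g ^^ m) y = 0"
    using dl_nilpotent [OF g] by blast
  obtain k where k: "(dl g ^^ Suc (Suc k)) c = 0" "(dl g ^^ Suc k) c \<noteq> 0"
    using dl_nilpotent_witness [OF m, of c] \<open>g * c \<noteq> c * g\<close> g0 by (auto simp: dl_eq_0_iff)
  define u where "u = (dl g ^^ k) c"
  define e where "e = dl g u"
  define y where "y = u * inverse e"
  have e: "e \<noteq> 0" "g * e = e * g" "e \<in> K" "u \<in> K"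
    using k g0 dl_mem [OF g(1) c, of "Suc k"] dl_mem [OF g(1) c, of k]
    by (auto simp: u_def e_def dl_eq_0_iff)
  have "g * inverse e = inverse e * g"
    using commute_inverse [of e g] e(2) by simp
  then have "dl g y = e * inverse e"
    using dl_mult_right [OF g0, of "inverse e" 1 u] by (simp add: y_def e_def)
  then have dy: "dl g y = 1"
    using e(1) by simp
  then have cy: "cj g y = y - 1"
    by (simp add: dl_def algebra_simps)
  have y: "y \<in> K" "y \<noteq> 0"
    using dy by (auto simp: y_def intro!: KD e)
  define E where "E = centralizer (centralizer {y})"
  have "division_subring E"
    unfolding E_def by (rule division_subring_centralizer)
  note ED = division_subringD [OF this]
  have sub: "E \<subseteq> centralizer {y}"
    by (auto simp: E_def centralizer_def)
  have "g * y = y * g"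
  proof (rule commute_if_nilpotent [OF g(1) m])
    show "a * b = b * a" if "a \<in> E" "b \<in> E" for a b
      using that sub unfolding E_def centralizer_def by blast
    show "cj g a \<in> E" if "a \<in> E" for a
      unfolding E_def
    proof (rule centralizer_cj [OF g0])
      show "a \<in> centralizer (centralizer {y})"
        using that by (simp add: E_def)
      fix s
      assume "s \<in> centralizer {y}"
      then have "s * y = y * s"
        by (simp add: centralizer_def)
      then have "cj g (cj (inverse g) s * y) = cj g (y * cj (inverse g) s)"
        using g0 by (simp add: cj_mult cj_cj_inverse cy algebra_simps)
      then show "cj (inverse g) s \<in> centralizer {y}"
        using g0 by (simp add: cj_inject centralizer_def)
    qed
    show "y \<in> E"
      by (simp add: E_def centralizer_def)
  qed (auto intro: ED simp: y)
  then show False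
    using dy g0 dl_eq_0_iff [of g y] by simp
qed

lemma stable_subring_centralizer:
  assumes "S \<subseteq> K" "centralizer S \<noteq> UNIV" "\<And>g s. g \<in> N \<Longrightarrow> s \<in> S \<Longrightarrow> cj g s \<in> S"
  shows "stable_subring (centralizer S) N r"
proof
  have "centralizer S \<inter> ring_center = ring_center"
    by (auto simp: centralizer_def ring_center_def)
  then show "infinite (centralizer S \<inter> ring_center)"
    using infinite_center by simp
  show "cj g a \<in> centralizer S" if "g \<in> N" "a \<in> centralizer S" for g a
    using that ND by (intro centralizer_cj assms) auto
qed (use assms N division_subring_centralizer in auto)

text \<open>The center \<open>E\<close> of \<open>K\<close> satisfies the same hypotheses as \<open>K\<close>. Suppose \<open>g\<close> does not commute with
  \<open>c \<in> E\<close>; then \<open>g \<notin> E\<close>. For \<open>z\<close> and \<open>x = g z\<close> both in the image of \<open>\<delta>\<^sup>r\<close>, the commutators with \<open>c\<close> lie in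
  \<open>E\<close>, which forces \<open>x = a + b g\<close> with \<open>a, b \<in> E\<close>, and a further commutator with \<open>c\<close> forces
  \<open>b = 0\<close>. So \<open>\<delta>\<^sup>r\<close> maps \<open>D\<close> into \<open>E\<close> and \<open>\<delta>\<close> is nilpotent, so that
  \<open>commute_if_nilpotent\<close> applies to \<open>c \<in> E\<close>.\<close>

lemma center_commute:
  assumes g: "g \<in> N" and c: "c \<in> K" "c \<in> centralizer K"
  shows "g * c = c * g"
proof (rule ccontr)
  assume gc: "g * c \<noteq> c * g"
  have g0: "g \<noteq> 0"
    using ND(1) [OF g] .
  define E where "E = K \<inter> centralizer K"
  have comm: "a * b = b * a" if "a \<in> E" "b \<in> E" for a b
    using that unfolding E_def centralizer_def by blast
  have "stable_subring E N r"
  proof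
    show "division_subring E"
      unfolding E_def by (intro division_subring_Int division_subring_centralizer K)
    have "E \<inter> ring_center = K \<inter> ring_center"
      by (auto simp: E_def centralizer_def ring_center_def)
    then show "infinite (E \<inter> ring_center)"
      using infinite_K by simp
    show "E \<noteq> UNIV"
      using proper by (auto simp: E_def)
    show "cj g k \<in> E" if "g \<in> N" "k \<in> E" for g k
      using that ND unfolding E_def by (auto intro!: centralizer_cj stable)
  qed (rule N)
  then interpret E: stable_subring E N r .
  have cE: "c \<in> E"
    using c by (simp add: E_def)
  then have gE: "g \<notin> E"
    using comm gc by blast
  define e where "e = cj g c - c"
  have eg: "e * g = g * c - c * g"
    using g0 by (simp add: e_def cj_def left_diff_distrib mult.assoc)
  have e: "e \<in> E" "e \<noteq> 0"
    using E.KD(3) [OF E.stable [OF g cE] cE] eg gc by (auto simp: e_def)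
  have "(dl g ^^ r) y \<in> E" for y
  proof -
    define x where "x = (dl g ^^ r) y"
    define z where "z = inverse g * x"
    define d where "d = z * c - c * z"
    have "g * inverse g = inverse g * g"
      using g0 by simp
    then have "z = (dl g ^^ r) (inverse g * y)"
      using dl_mult_left [OF g0] by (simp add: z_def x_def)
    then have d: "d \<in> E"
      using E.lie_mem [OF g cE] by (simp add: d_def)
    have xc: "x * c - c * x \<in> E"
      using E.lie_mem [OF g cE] by (simp add: x_def)
    have gz: "g * z = x"
      using g0 by (simp add: z_def mult.assoc [symmetric])
    have "x * c - c * x = g * d + (g * c - c * g) * z"
      by (simp add: d_def gz [symmetric] algebra_simps)
    also have "\<dots> = cj g d * g + e * x"
      using g0 by (simp add: eg [symmetric] mult.assoc gz) (simp add: cj_def mult.assoc)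
    finally have "inverse e * (x * c - c * x - cj g d * g) = x"
      using e(2) by (simp add: mult.assoc [symmetric])
    then have x: "x = inverse e * (x * c - c * x) + (- (inverse e * cj g d)) * g"
      by (simp add: right_diff_distrib mult.assoc)
    define a b where "a = inverse e * (x * c - c * x)" and "b = - (inverse e * cj g d)"
    have ab: "a \<in> E" "b \<in> E" "x = a + b * g"
      using x unfolding a_def b_def
      by (auto intro!: E.KD(4) [OF E.KD(5)] E.KD(6) E.stable xc d e g)
    have "b = 0"
    proof (rule ccontr)
      assume "b \<noteq> 0"
      have "x * c - c * x = b * (g * c) - (c * b) * g"
        using comm [OF ab(1) cE] by (simp add: ab(3) algebra_simps)
      also have "\<dots> = b * e * g"
        unfolding comm [OF ab(2) cE, symmetric] by (simp add: eg mult.assoc right_diff_distrib)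
      finally have "b * e * g \<in> E"
        using xc by simp
      then have "inverse (b * e) * (b * e * g) \<in> E"
        by (rule E.KD(4) [OF E.KD(5) [OF E.KD(4) [OF ab(2) e(1)]]])
      moreover have "inverse (b * e) * (b * e * g) = g"
        using \<open>b \<noteq> 0\<close> e(2) by (subst mult.assoc [symmetric], subst left_inverse) simp_all
      ultimately show False
        using gE by simp
    qed
    then show ?thesis
      using ab x_def by simp
  qed
  then obtain m where m: "\<And>y. (dl g ^^ m) y = 0"
    using E.dl_nilpotent_if_into [OF g, of r] by blast
  have "c \<noteq> 0"
    using gc by auto
  then have "g * c = c * g"
    using cE c(1) E.stable [OF g] comm
    by (intro commute_if_nilpotent [OF g m, of E]) (auto intro: E.KD)
  then show False
    using gc by simp
qed

lemma N_centralizes: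
  assumes g: "g \<in> N" and x: "x \<in> K"
  shows "g * x = x * g"
proof -
  have g0: "g \<noteq> 0"
    using ND(1) [OF g] .
  \<comment> \<open>\<open>\<omega>\<^sup>r u\<close> lies in \<open>N \<inter> K\<close>, hence in the center of \<open>K\<close>, which commutes with \<open>g\<close>.\<close>
  have om: "(om g ^^ Suc r) u = 1" if u: "u \<in> K" "u \<noteq> 0" for u
  proof -
    define h where "h = (om g ^^ r) u"
    have h: "h \<in> N" "h \<in> K" "h \<noteq> 0"
      unfolding h_def using om_funpow_subnormal [OF N g u(2)] om_mem [OF g u(1)]
        om_funpow_nz [OF g0 u(2)] by auto
    then have "h \<in> centralizer K"
      using Int_commute by (auto simp: centralizer_def)
    then have "g * h = h * g"
      by (rule center_commute [OF g h(2)])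
    then show ?thesis
      using om_eq_1_iff [OF g0 h(3)] by (simp add: h_def)
  qed
  have "(dl g ^^ Suc r) y = 0" if "y \<in> K" for y
    by (rule dl_funpow_eq_0_from_om [OF infinite_K _ g0]) (auto simp del: funpow.simps intro!: om KD that)
  then show ?thesis
    using om_nilpotent [OF g0, of x "Suc r" r] om_mem [OF g x] om [OF x]
    by (cases "x = 0") auto
qed

text \<open>If \<open>K\<close> is not central, then the centralizer \<open>L\<close> of \<open>K\<close> is proper, and it contains \<open>N\<close>. Thus \<open>N = N \<inter> L\<close>
  centralizes \<open>L\<close>, in particular \<open>N\<close> is abelian, and \<open>\<omega>\<^sup>r\<^sup>+\<^sup>1 x = 1\<close> for all nonzero \<open>x \<in> D\<close>.\<close>

lemma central:
  assumes "\<not> N \<subseteq> ring_center"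
  shows "K \<subseteq> ring_center"
proof (rule ccontr)
  assume "\<not> K \<subseteq> ring_center"
  then obtain k x where "k \<in> K" "k * x \<noteq> x * k"
    unfolding ring_center_def by blast
  then have "x \<notin> centralizer K"
    unfolding centralizer_def by force
  then have "centralizer K \<noteq> UNIV"
    by blast
  then interpret L: stable_subring "centralizer K" N r
    by (intro stable_subring_centralizer stable) auto
  have NL: "g \<in> centralizer K" if "g \<in> N" for g
    using N_centralizes that by (auto simp: centralizer_def)
  have "g \<in> ring_center" if g: "g \<in> N" for g
  proof -
    have g0: "g \<noteq> 0"
      using ND(1) [OF g] .
    have om: "(om g ^^ Suc r) u = 1" if u: "u \<noteq> 0" for u
    proof -
      have "(om g ^^ r) u \<in> N"
        by (rule om_funpow_subnormal [OF N g u])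
      then have "g * (om g ^^ r) u = (om g ^^ r) u * g"
        using L.Int_commute [OF g NL [OF g] NL] by blast
      then show ?thesis
        using om_eq_1_iff [OF g0 om_funpow_nz [OF g0 u]] by simp
    qed
    have "(dl g ^^ Suc r) y = 0" for y
      by (rule dl_funpow_eq_0_from_om [OF infinite_center _ g0]) (auto simp del: funpow.simps intro!: om)
    then have "g * x = x * g" for x
      using om_nilpotent [OF g0, of x "Suc r" r] om [of x] by (cases "x = 0") auto
    then show ?thesis
      by (simp add: ring_center_def)
  qed
  then show False
    using assms by blast
qed

end

section \<open>Invariant division subrings containing few central elements\<close>

lemma eventually_generic_inverse:
  assumes "\<forall>\<^sub>F t in generic. P t"
  shows "\<forall>\<^sub>F t in generic. P (inverse t)"
proof -
  have "finite (inverse ` {t \<in> ring_center. \<not> P t})"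
    using assms by (simp add: eventually_generic)
  moreover have "{t \<in> ring_center. \<not> P (inverse t)} \<subseteq> inverse ` {t \<in> ring_center. \<not> P t}"
  proof
    fix t
    assume "t \<in> {t \<in> ring_center. \<not> P (inverse t)}"
    then show "t \<in> inverse ` {t \<in> ring_center. \<not> P t}"
      using division_subringD(5) [OF division_subring_center, of t]
      by (intro image_eqI [of _ _ "inverse t"]) auto
  qed
  ultimately show ?thesis
    unfolding eventually_generic using finite_subset by blast
qed

lemma om_center_mult:
  assumes "t \<in> ring_center" "t \<noteq> 0" "g \<noteq> 0" "u \<noteq> 0"
  shows "om g (t * u) = om g u"
proof -
  have "cj g t = t"
    using assms centerD [OF assms(1), of g] by (simp add: cj_eq_iff)
  then have "om g (t * u) = t * (u * inverse (cj g u)) * inverse t"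
    using assms by (simp add: om_def cj_mult nonzero_inverse_mult_distrib cj_eq_0_iff mult.assoc)
  also have "\<dots> = u * inverse (cj g u)"
    using assms(2) centerD [OF assms(1)] by (simp add: mult.assoc)
  finally show ?thesis
    by (simp add: om_def)
qed

lemma cj_om_center_mult:
  assumes "t \<in> ring_center" "t \<noteq> 0" "g \<noteq> 0" "u \<noteq> 0"
  shows "cj ((om g ^^ i) (t * u)) c = cj ((om g ^^ i) u) c"
proof (cases i)
  case 0
  have "t * u * c * inverse (t * u) = t * (u * c * inverse u) * inverse t"
    using assms by (simp add: nonzero_inverse_mult_distrib mult.assoc)
  also have "\<dots> = u * c * inverse u"
    using assms(2) centerD [OF assms(1), of "u * c * inverse u"] by (simp add: mult.assoc)
  finally show ?thesis
    using 0 by (simp add: cj_def)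
next
  case (Suc j)
  then have "(om g ^^ i) v = (om g ^^ j) (om g v)" for v
    by (simp add: funpow_swap1)
  then show ?thesis
    using om_center_mult [OF assms] by simp
qed

text \<open>Suppose that \<open>K\<close> is not central. Its centralizer contains the infinite center \<open>F\<close>, so the preceding
  section shows that it equals \<open>F\<close>.\<close>

lemma central_if_finite_Int_center:
  fixes K N :: "'a::division_ring set"
  assumes inf: "infinite (ring_center :: 'a set)" and K: "division_subring K"
    and fin: "finite (K \<inter> ring_center)" and N: "subnormal r N"
    and stable: "\<And>g k. g \<in> N \<Longrightarrow> k \<in> K \<Longrightarrow> cj g k \<in> K" and noncentral: "\<not> N \<subseteq> ring_center"
  shows "K \<subseteq> ring_center"
proof (rule ccontr)
  assume "\<not> K \<subseteq> ring_center"
  note KD = division_subringD [OF K]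
  note ND = mult_subgroupD [OF subnormal_mult_subgroup [OF N]]
  interpret L: stable_subring "centralizer K" N r
  proof
    show "division_subring (centralizer K)"
      by (rule division_subring_centralizer)
    have "centralizer K \<inter> ring_center = ring_center"
      by (auto simp: centralizer_def ring_center_def)
    then show "infinite (centralizer K \<inter> ring_center)"
      using inf by simp
    obtain k x where "k \<in> K" "k * x \<noteq> x * k"
      using \<open>\<not> K \<subseteq> ring_center\<close> unfolding ring_center_def by blast
    then have "x \<notin> centralizer K"
      unfolding centralizer_def by force
    then show "centralizer K \<noteq> UNIV"
      by blast
    show "cj g a \<in> centralizer K" if "g \<in> N" "a \<in> centralizer K" for g a
      using that ND by (intro centralizer_cj stable) auto
  qed (rule N)
  have L: "a \<in> ring_center" if "\<And>c. c \<in> K \<Longrightarrow> a * c = c * a" for a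
    using L.central [OF noncentral] that by (auto simp: centralizer_def)
  have finZ: "finite (K \<inter> centralizer K)"
    using L.central [OF noncentral] fin by (meson Int_mono finite_subset subset_refl)
  \<comment> \<open>The conjugate of \<open>c\<close> by \<open>\<omega>\<^sup>r (a + t b) \<in> N\<close> is a rational function over \<open>K\<close> with values in \<open>K\<close>.\<close>
  have const: "\<forall>\<^sub>F t in generic. cj ((om g ^^ r) (a + t * b)) c = cj ((om g ^^ r) a) c"
    if g: "g \<in> N" and ab: "a \<in> K" "b \<in> K" "a \<noteq> 0" and c: "c \<in> K" for g a b c
  proof -
    have g0: "g \<noteq> 0"
      using ND(1) [OF g] .
    define w where "w = (\<lambda>t. (om g ^^ r) (a + t * b))"
    have w: "regular K w"
      unfolding w_def by (intro regular_om [OF inf K g0] stable g ab)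
    have w0: "w 0 \<noteq> 0"
      using om_funpow_nz [OF g0 ab(3)] by (simp add: w_def)
    have "regular K (\<lambda>t. w t * c * inverse (w t))"
      by (intro regular_mult [OF inf K] regular_inverse [OF inf K] regular_const [OF K] w w0 c)
    moreover have "\<forall>\<^sub>F t in generic. a + t * b \<noteq> 0"
      using regular_generic_nonzero [OF inf regular_linear [OF K ab(1,2)]] ab(3) by simp
    then have "\<forall>\<^sub>F t in generic. w t * c * inverse (w t) \<in> K"
    proof eventually_elim
      case (elim t)
      then have "w t \<in> N"
        unfolding w_def by (rule om_funpow_subnormal [OF N g])
      then show ?case
        using stable [OF _ c] by (simp add: cj_def)
    qed
    ultimately have "\<forall>\<^sub>F t in generic. w t * c * inverse (w t) = w 0 * c * inverse (w 0)"
      by (rule regular_generic_constant [OF inf K finZ])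
    then show ?thesis
      by (simp add: w_def cj_def)
  qed
  have one: "\<forall>\<^sub>F t in generic. cj ((om g ^^ r) (1 + t * x)) c = c"
    if g: "g \<in> N" and x: "x \<in> K" and c: "c \<in> K" for g x c
  proof -
    have "om g 1 = 1"
      using ND(1) [OF g] by (simp add: om_eq_1_iff)
    then have "(om g ^^ r) 1 = 1"
      by (induction r) simp_all
    then show ?thesis
      using const [OF g KD(2) x _ c] by (simp add: cj_def)
  qed
  \<comment> \<open>The families \<open>x + t\<close> and \<open>1 + t\<^sup>-\<^sup>1 x\<close> differ by the central factor \<open>t\<close>, so conjugation of \<open>c\<close> by
    \<open>\<omega>\<^sup>r\<close> of either gives the same generic constant, namely \<open>c\<close>. Its value for the first family at
    \<open>t = 0\<close> shows that \<open>\<omega>\<^sup>r x\<close> commutes with \<open>c\<close>.\<close>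
  have om: "(om g ^^ Suc r) x = 1" if g: "g \<in> N" and x: "x \<in> K" "x \<noteq> 0" for g x
  proof -
    have g0: "g \<noteq> 0"
      using ND(1) [OF g] .
    have w0: "(om g ^^ r) x \<noteq> 0"
      using om_funpow_nz [OF g0 x(2)] .
    have "(om g ^^ r) x * c = c * (om g ^^ r) x" if c: "c \<in> K" for c
    proof -
      have nz: "\<forall>\<^sub>F t in generic. 1 + t * x \<noteq> 0"
        using regular_generic_nonzero [OF inf regular_linear [OF K KD(2) x(1)]] by simp
      have ev: "\<forall>\<^sub>F t in (generic :: 'a filter). cj ((om g ^^ r) x) c = c"
        using eventually_generic_inverse [OF one [OF g x(1) c]] eventually_generic_inverse [OF nz]
          const [OF g x(1) KD(2) x(2) c] eventually_generic_center eventually_generic_nonzero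
      proof eventually_elim
        case (elim t)
        have "x + t * 1 = t * (1 + inverse t * x)"
          using elim(5) by (simp add: distrib_left mult.assoc [symmetric])
        then show ?case
          using elim cj_om_center_mult [OF elim(4,5) g0 elim(2), of r c] by simp
      qed
      have "infinite {t \<in> (ring_center :: 'a set). cj ((om g ^^ r) x) c = c}"
        by (rule eventually_generic_infinite [OF ev inf order_refl])
      then have "cj ((om g ^^ r) x) c = c"
        by (rule contrapos_np) simp
      then show ?thesis
        using w0 by (simp add: cj_eq_iff)
    qed
    then have "(om g ^^ r) x \<in> ring_center"
      by (rule L)
    then have "g * (om g ^^ r) x = (om g ^^ r) x * g"
      by (metis centerD)
    then show ?thesis
      using w0 g0 by (simp add: om_eq_1_iff)
  qed
  \<comment> \<open>The first-order term of \<open>\<omega>\<^sup>r (1 + t x)\<close>, which commutes with \<open>c\<close> for generic \<open>t\<close>.\<close>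
  have dl: "(dl g ^^ Suc r) x = 0" if g: "g \<in> N" and x: "x \<in> K" for g x
  proof -
    have g0: "g \<noteq> 0"
      using ND(1) [OF g] .
    have "(dl g ^^ r) x * c = c * (dl g ^^ r) x" if c: "c \<in> K" for c
    proof -
      obtain h where h: "regular UNIV h" "h 0 = (dl g ^^ r) x"
          "\<forall>\<^sub>F t in generic. (om g ^^ r) (1 + t * x) = 1 + t * h t"
        using om_first_order [OF inf division_subring_UNIV g0] by blast
      have nz: "\<forall>\<^sub>F t in generic. 1 + t * x \<noteq> 0"
        using regular_generic_nonzero [OF inf regular_linear [OF K KD(2) x(1)]] by simp
      have "\<forall>\<^sub>F t in generic. h t * c - c * h t = 0"
        using h(3) one [OF g x c] nz eventually_generic_center eventually_generic_nonzero
      proof eventually_elim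
        case (elim t)
        have "1 + t * h t \<noteq> 0"
          using om_funpow_nz [OF g0 elim(3), of r] unfolding elim(1) .
        then have "(1 + t * h t) * c = c * (1 + t * h t)"
          using elim(1,2) by (simp add: cj_eq_iff)
        moreover have "t * (h t * c - c * h t) = (1 + t * h t) * c - c * (1 + t * h t)"
          using centerD [OF elim(4), of c]
          by (simp add: distrib_left distrib_right right_diff_distrib mult.assoc [symmetric])
        ultimately show ?case
          using elim(5) by simp
      qed
      moreover have "regular UNIV (\<lambda>t. h t * c - c * h t)"
        by (intro regular_diff [OF inf] regular_mult [OF inf] regular_const h division_subring_UNIV UNIV_I)
      ultimately have "h 0 * c - c * h 0 = 0"
        using regular_generic_zero [OF inf, of UNIV "\<lambda>t. h t * c - c * h t"] by blast
      then show ?thesis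
        using h(2) by simp
    qed
    then have "(dl g ^^ r) x \<in> ring_center"
      by (rule L)
    then have "g * (dl g ^^ r) x = (dl g ^^ r) x * g"
      by (metis centerD)
    then show ?thesis
      using g0 by (simp add: dl_eq_0_iff)
  qed
  have "g * x = x * g" if g: "g \<in> N" and x: "x \<in> K" for g x
  proof (cases "x = 0")
    case False
    have "(om g ^^ n) x \<in> K" for n
      by (induction n) (use x in \<open>auto simp: om_def intro: KD stable g\<close>)
    then show ?thesis
      by (intro om_nilpotent [OF ND(1) [OF g] False dl [OF g] om [OF g x False]])
  qed simp
  then have "N \<subseteq> ring_center"
    using L by blast
  then show False
    using noncentral by blast
qed

theorem subnormal_invariant_division_subring:
  fixes K N :: "'a::division_ring set"
  assumes "infinite (ring_center :: 'a set)" "division_subring K" "subnormal r N"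
    and "\<And>g k. g \<in> N \<Longrightarrow> k \<in> K \<Longrightarrow> cj g k \<in> K" "\<not> N \<subseteq> ring_center"
  shows "K \<subseteq> ring_center \<or> K = UNIV"
proof (cases "finite (K \<inter> ring_center) \<or> K = UNIV")
  case True
  then show ?thesis
    using central_if_finite_Int_center [OF assms(1,2) _ assms(3-5)] by blast
next
  case False
  interpret stable_subring K N r
  proof unfold_locales
    show "infinite (K \<inter> ring_center)" "K \<noteq> UNIV"
      using False by blast+
  qed (fact assms)+
  show ?thesis
    using central [OF assms(5)] by simp
qed

section \<open>Almost subnormal subgroups\<close>

text \<open>Finite index, for subgroups \<open>H \<subseteq> G\<close> of \<open>D\<^sup>*\<close>: a function with finitely many values on \<open>G\<close> separates the
  right cosets of \<open>H\<close>. The values are taken in \<open>'a\<close>, where coset representatives live; the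
  introduction rule allows any type of values.\<close>

definition fin_index :: "'a::division_ring set \<Rightarrow> 'a set \<Rightarrow> bool" where
  "fin_index H G \<longleftrightarrow>
    (\<exists>f :: 'a \<Rightarrow> 'a. finite (f ` G) \<and> (\<forall>x\<in>G. \<forall>y\<in>G. f x = f y \<longrightarrow> x * inverse y \<in> H))"

lemma fin_indexI:
  assumes "finite (f ` G)" "\<And>x y. x \<in> G \<Longrightarrow> y \<in> G \<Longrightarrow> f x = f y \<Longrightarrow> x * inverse y \<in> H"
  shows "fin_index H G"
proof -
  define s where "s = (\<lambda>c. SOME x. x \<in> G \<and> f x = c)"
  have s: "s (f x) \<in> G \<and> f (s (f x)) = f x" if "x \<in> G" for x
    unfolding s_def by (rule someI [of _ x]) (simp add: that)
  have "(\<lambda>x. s (f x)) ` G = s ` f ` G"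
    by auto
  then have "finite ((\<lambda>x. s (f x)) ` G)"
    using assms(1) by simp
  moreover have "x * inverse y \<in> H" if "x \<in> G" "y \<in> G" "s (f x) = s (f y)" for x y
    using assms(2) s that by metis
  ultimately show ?thesis
    unfolding fin_index_def by blast
qed

lemma fin_index_mono:
  assumes "fin_index H G" "G' \<subseteq> G" "\<And>x. x \<in> H \<Longrightarrow> x \<in> H'"
  shows "fin_index H' G'"
proof -
  obtain f :: "'a \<Rightarrow> 'a" where f: "finite (f ` G)"
      "\<And>x y. x \<in> G \<Longrightarrow> y \<in> G \<Longrightarrow> f x = f y \<Longrightarrow> x * inverse y \<in> H"
    using assms(1) unfolding fin_index_def by blast
  show ?thesis
  proof (rule fin_indexI)
    show "finite (f ` G')"
      using f(1) assms(2) by (meson finite_subset image_mono)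
    fix x y
    assume "x \<in> G'" "y \<in> G'" "f x = f y"
    then show "x * inverse y \<in> H'"
      using f(2) assms(2,3) by blast
  qed
qed

lemma fin_index_Int:
  assumes "fin_index H G" "mult_subgroup G'" "G' \<subseteq> G"
  shows "fin_index (H \<inter> G') G'"
proof -
  obtain f :: "'a \<Rightarrow> 'a" where f: "finite (f ` G)"
      "\<And>x y. x \<in> G \<Longrightarrow> y \<in> G \<Longrightarrow> f x = f y \<Longrightarrow> x * inverse y \<in> H"
    using assms(1) unfolding fin_index_def by blast
  show ?thesis
  proof (rule fin_indexI)
    show "finite (f ` G')"
      using f(1) assms(3) by (meson finite_subset image_mono)
    fix x y
    assume xy: "x \<in> G'" "y \<in> G'" "f x = f y"
    then have "x * inverse y \<in> H"
      using f(2) assms(3) by blast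
    moreover have "x * inverse y \<in> G'"
      by (intro mult_subgroupD [OF assms(2)] xy)
    ultimately show "x * inverse y \<in> H \<inter> G'"
      by blast
  qed
qed

lemma fin_index_trans:
  assumes "fin_index A H" "fin_index H G" "mult_subgroup G"
  shows "fin_index A G"
proof -
  obtain f :: "'a \<Rightarrow> 'a" where f: "finite (f ` H)"
      "\<And>x y. x \<in> H \<Longrightarrow> y \<in> H \<Longrightarrow> f x = f y \<Longrightarrow> x * inverse y \<in> A"
    using assms(1) unfolding fin_index_def by blast
  obtain e :: "'a \<Rightarrow> 'a" where e: "finite (e ` G)"
      "\<And>x y. x \<in> G \<Longrightarrow> y \<in> G \<Longrightarrow> e x = e y \<Longrightarrow> x * inverse y \<in> H"
    using assms(2) unfolding fin_index_def by blast
  note GD = mult_subgroupD [OF assms(3)]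
  define s where "s = (\<lambda>c. SOME x. x \<in> G \<and> e x = c)"
  have s: "s (e x) \<in> G \<and> e (s (e x)) = e x" if "x \<in> G" for x
    unfolding s_def by (rule someI [of _ x]) (simp add: that)
  define d where "d = (\<lambda>x. x * inverse (s (e x)))"
  have d: "d x \<in> H" if "x \<in> G" for x
    unfolding d_def using e(2) s that by metis
  show ?thesis
  proof (rule fin_indexI)
    have "(\<lambda>x. (e x, f (d x))) ` G \<subseteq> e ` G \<times> f ` H"
      using d by auto
    then show "finite ((\<lambda>x. (e x, f (d x))) ` G)"
      using e(1) f(1) finite_subset by blast
    show "x * inverse y \<in> A" if xy: "x \<in> G" "y \<in> G" "(e x, f (d x)) = (e y, f (d y))" for x y
    proof -
      have "d x * inverse (d y) \<in> A"
        using f(2) d xy by simp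
      moreover have "s (e x) \<noteq> 0" "y \<noteq> 0"
        using s xy GD(1) by auto
      ultimately show ?thesis
        using xy(3) by (simp add: d_def nonzero_inverse_mult_distrib mult.assoc)
          (simp add: mult.assoc [symmetric])
    qed
  qed
qed

text \<open>The core of \<open>A\<close> in \<open>H\<close>, for \<open>A \<subseteq> H\<close> the largest subgroup of \<open>A\<close> that is normal in \<open>H\<close>.\<close>

definition core :: "'a::division_ring set \<Rightarrow> 'a set \<Rightarrow> 'a set" where
  "core A H = {c \<in> H. \<forall>x\<in>H. cj x c \<in> A}"

lemma core_subset: "mult_subgroup H \<Longrightarrow> core A H \<subseteq> A"
proof
  fix c
  assume "mult_subgroup H" "c \<in> core A H"
  then have "cj 1 c \<in> A"
    using mult_subgroupD(2) unfolding core_def by blast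
  then show "c \<in> A"
    by (simp add: cj_def)
qed

lemma cj_mult_left:
  assumes "x \<noteq> 0" "y \<noteq> 0"
  shows "cj (x * y) c = cj x (cj y c)"
  unfolding cj_def nonzero_inverse_mult_distrib [OF assms] by (simp only: mult.assoc)

lemma core_normal:
  assumes H: "mult_subgroup H" and A: "mult_subgroup A"
  shows "mult_subgroup (core A H)" "normal_in (core A H) H"
proof -
  note HD = mult_subgroupD [OF H] and AD = mult_subgroupD [OF A]
  show "mult_subgroup (core A H)"
    unfolding mult_subgroup_def
  proof (intro conjI ballI)
    show "0 \<notin> core A H"
      using HD(1) by (auto simp: core_def)
    show "1 \<in> core A H"
      using HD AD(2) by (auto simp: core_def cj_1)
    show "x * y \<in> core A H" if "x \<in> core A H" "y \<in> core A H" for x y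
      using that HD AD by (auto simp: core_def cj_mult)
    show "inverse x \<in> core A H" if "x \<in> core A H" for x
      using that HD AD by (auto simp: core_def cj_inverse)
  qed
  show "normal_in (core A H) H"
    unfolding normal_in_def
  proof (intro conjI ballI)
    show "core A H \<subseteq> H"
      by (auto simp: core_def)
    fix g h
    assume g: "g \<in> H" and h: "h \<in> core A H"
    have "cj g h \<in> H"
      using HD g h by (simp add: cj_def core_def)
    moreover have "cj x (cj g h) \<in> A" if "x \<in> H" for x
    proof -
      have "cj (x * g) h \<in> A"
        using h HD(3) [OF that g] by (simp add: core_def)
      then show ?thesis
        using cj_mult_left [of x g h] HD(1) that g by simp
    qed
    ultimately show "cj g h \<in> core A H"
      by (simp add: core_def)
  qed
qed

text \<open>Right multiplication by \<open>c\<close> permutes the right cosets of \<open>A\<close>, and \<open>F c\<close>, one of finitely many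
  relations, determines this permutation. If \<open>F c = F d\<close>, then \<open>c d\<^sup>-\<^sup>1\<close> fixes every coset, so it lies in the core.\<close>

lemma fin_index_core:
  assumes "fin_index A H" and H: "mult_subgroup H" and A: "mult_subgroup A"
  shows "fin_index (core A H) H"
proof -
  note HD = mult_subgroupD [OF H] and AD = mult_subgroupD [OF A]
  obtain f :: "'a \<Rightarrow> 'a" where f: "finite (f ` H)"
      "\<And>x y. x \<in> H \<Longrightarrow> y \<in> H \<Longrightarrow> f x = f y \<Longrightarrow> x * inverse y \<in> A"
    using assms(1) unfolding fin_index_def by blast
  define F where "F = (\<lambda>c. (\<lambda>x. (f x, f (x * c))) ` H)"
  show ?thesis
  proof (rule fin_indexI)
    have "F ` H \<subseteq> Pow (f ` H \<times> f ` H)"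
      using HD(3) by (auto simp: F_def)
    then show "finite (F ` H)"
      using f(1) finite_subset by blast
    show "c * inverse d \<in> core A H" if cd: "c \<in> H" "d \<in> H" "F c = F d" for c d
      unfolding core_def
    proof (intro CollectI conjI ballI)
      show "c * inverse d \<in> H"
        using cd HD by blast
      fix x
      assume x: "x \<in> H"
      then have "(f x, f (x * c)) \<in> F d"
        using cd(3) unfolding F_def by blast
      then obtain y where y: "y \<in> H" "f x = f y" "f (x * c) = f (y * d)"
        unfolding F_def by blast
      have "x * c * inverse (y * d) \<in> A" "y * inverse x \<in> A"
        using f(2) [of "x * c" "y * d"] f(2) [of y x] HD cd x y by auto
      then have "x * c * inverse (y * d) * (y * inverse x) \<in> A"
        by (rule AD(3))
      moreover have "y \<noteq> 0" "d \<noteq> 0"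
        using y cd HD(1) by auto
      then have "x * c * inverse (y * d) * (y * inverse x) = cj x (c * inverse d)"
        by (simp add: cj_def nonzero_inverse_mult_distrib mult.assoc)
           (simp add: mult.assoc [symmetric])
      ultimately show "cj x (c * inverse d) \<in> A"
        by simp
    qed
  qed
qed

text \<open>Almost subnormal subgroups of \<open>D\<^sup>*\<close>, generated from the top by normal steps and steps of finite
  index.\<close>

inductive almost_sub :: "'a::division_ring set \<Rightarrow> bool" where
  base: "almost_sub (- {0})"
| normal: "almost_sub G \<Longrightarrow> mult_subgroup H \<Longrightarrow> normal_in H G \<Longrightarrow> almost_sub H"
| fin_index: "almost_sub G \<Longrightarrow> mult_subgroup H \<Longrightarrow> H \<subseteq> G \<Longrightarrow> fin_index H G \<Longrightarrow> almost_sub H"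

lemma almost_sub_mult_subgroup: "almost_sub H \<Longrightarrow> mult_subgroup H"
  by (erule almost_sub.cases) (simp_all add: mult_subgroup_nonzero)

lemma mult_subgroup_Int: "mult_subgroup G \<Longrightarrow> mult_subgroup H \<Longrightarrow> mult_subgroup (G \<inter> H)"
  unfolding mult_subgroup_def by blast

text \<open>Induction along the series. At a step of finite index \<open>N \<subseteq> G\<close>, with \<open>H\<close> subnormal of finite index in
  \<open>G\<close>, the core of \<open>N \<inter> H\<close> in \<open>H\<close> is normal in \<open>H\<close> and of finite index in \<open>G\<close>.\<close>

lemma almost_sub_subnormal:
  assumes "almost_sub N"
  shows "\<exists>H r. subnormal r H \<and> H \<subseteq> N \<and> fin_index H N"
  using assms
proof (induction rule: almost_sub.induct)
  case base
  have "fin_index (- {0}) (- {0 :: 'a})"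
    by (rule fin_indexI [of "\<lambda>_. ()"]) auto
  then show ?case
    by (intro exI [of _ "- {0}"] exI [of _ 0]) auto
next
  case (normal G N)
  then obtain H r where H: "subnormal r H" "H \<subseteq> G" "fin_index H G"
    by blast
  have NG: "N \<subseteq> G" "\<And>g n. g \<in> G \<Longrightarrow> n \<in> N \<Longrightarrow> cj g n \<in> N"
    using normal.hyps by (auto simp: normal_in_def)
  note HD = mult_subgroupD [OF subnormal_mult_subgroup [OF H(1)]]
  have "mult_subgroup (H \<inter> N)"
    by (rule mult_subgroup_Int [OF subnormal_mult_subgroup [OF H(1)] normal.hyps(2)])
  moreover have "normal_in (H \<inter> N) H"
    using NG H(2) HD by (auto simp: normal_in_def cj_def)
  ultimately have "subnormal (Suc r) (H \<inter> N)"
    using H(1) by auto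
  then show ?case
    using fin_index_Int [OF H(3) normal.hyps(2) NG(1)] by blast
next
  case (fin_index G N)
  then obtain H r where H: "subnormal r H" "H \<subseteq> G" "fin_index H G"
    by blast
  note Hsub = subnormal_mult_subgroup [OF H(1)]
  define A where "A = N \<inter> H"
  have A: "mult_subgroup A"
    unfolding A_def by (rule mult_subgroup_Int [OF fin_index.hyps(2) Hsub])
  have "fin_index A H"
    unfolding A_def by (rule fin_index_Int [OF fin_index.hyps(4) Hsub H(2)])
  then have C: "fin_index (core A H) H"
    by (rule fin_index_core [OF _ Hsub A])
  have "subnormal (Suc r) (core A H)"
    using H(1) core_normal [OF Hsub A] by auto
  moreover have CN: "core A H \<subseteq> N"
    using core_subset [OF Hsub, of A] by (auto simp: A_def)
  moreover have "fin_index (core A H) G"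
    by (rule fin_index_trans [OF C H(3) almost_sub_mult_subgroup [OF fin_index.hyps(1)]])
  then have "fin_index (core A H) N"
    by (rule fin_index_mono) (use fin_index.hyps in auto)
  ultimately show ?case
    by blast
qed

text \<open>Apply the subnormal case to the centralizer of \<open>a\<close>, which contains \<open>H\<close>.\<close>

lemma subnormal_commuting_central:
  fixes a :: "'a::division_ring"
  assumes inf: "infinite (ring_center :: 'a set)" and H: "subnormal r H" and a: "a \<notin> ring_center"
    and comm: "\<And>h. h \<in> H \<Longrightarrow> h * a = a * h"
  shows "H \<subseteq> ring_center"
proof (rule ccontr)
  assume noncentral: "\<not> H \<subseteq> ring_center"
  define C where "C = centralizer {a}"
  have C: "division_subring C"
    unfolding C_def by (rule division_subring_centralizer)
  have "cj h k \<in> C" if "h \<in> H" "k \<in> C" for h k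
  proof -
    have "h \<in> C"
      using comm that by (simp add: C_def centralizer_def)
    then show ?thesis
      unfolding cj_def by (intro division_subringD [OF C] that)
  qed
  then have "C \<subseteq> ring_center \<or> C = UNIV"
    by (rule subnormal_invariant_division_subring [OF inf C H _ noncentral])
  then have "C = UNIV"
    using a by (auto simp: C_def centralizer_def)
  then have "x * a = a * x" for x
    by (auto simp: C_def centralizer_def)
  then show False
    using a by (simp add: ring_center_def)
qed

lemma finite_roots_of_unity_center:
  assumes inf: "infinite (ring_center :: 'a::division_ring set)" and "m > 0"
  shows "finite {z \<in> ring_center. z ^ m = (1 :: 'a)}"
proof (rule ccontr)
  assume "infinite {z \<in> ring_center. z ^ m = (1 :: 'a)}"
  moreover have "poly_fun UNIV (Suc m) (\<lambda>t::'a. t ^ m - 1)"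
  proof (intro poly_fun_diff division_subring_UNIV)
    show "poly_fun UNIV (Suc m) (\<lambda>t::'a. t ^ m)"
      unfolding poly_fun_def
      by (intro exI [of _ "\<lambda>i. if i = m then 1 else 0"]) (simp add: if_distribR sum.If_cases)
    show "poly_fun UNIV (Suc m) (\<lambda>t::'a. 1)"
      by (rule poly_fun_mono [OF poly_fun_const [of 1 UNIV]]) auto
  qed
  ultimately have "\<forall>t\<in>ring_center. t ^ m - (1 :: 'a) = 0"
    by (intro poly_fun_zeros) simp_all
  then have "(0 :: 'a) ^ m - 1 = 0"
    using zero_center by blast
  then show False
    using assms(2) by (simp add: power_0_left)
qed

lemma cj_power: "g \<noteq> 0 \<Longrightarrow> cj g (x ^ n) = cj g x ^ n"
  by (induction n) (simp_all add: cj_1 cj_mult)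

lemma mult_subgroup_power: "mult_subgroup H \<Longrightarrow> x \<in> H \<Longrightarrow> x ^ n \<in> H"
  by (induction n) (simp_all add: mult_subgroup_def)

lemma center_mult_power:
  assumes "z \<in> ring_center"
  shows "(z * y) ^ n = z ^ n * y ^ n"
proof (induction n)
  case (Suc n)
  have "z * y * (z ^ n * y ^ n) = z * z ^ n * (y * y ^ n)"
    using centerD [OF center_power [OF assms, of n], of y] by (metis mult.assoc)
  then show ?case
    using Suc by simp
qed simp

lemma fin_index_power:
  assumes "fin_index H G" "mult_subgroup G" "x \<in> G"
  shows "\<exists>m>0. x ^ m \<in> H"
proof -
  obtain f :: "'a \<Rightarrow> 'a" where f: "finite (f ` G)"
      "\<And>x y. x \<in> G \<Longrightarrow> y \<in> G \<Longrightarrow> f x = f y \<Longrightarrow> x * inverse y \<in> H"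
    using assms(1) unfolding fin_index_def by blast
  have xG: "x ^ n \<in> G" for n
    by (rule mult_subgroup_power [OF assms(2,3)])
  have x0: "x \<noteq> 0"
    using mult_subgroupD(1) [OF assms(2,3)] .
  have "finite (range (\<lambda>n::nat. f (x ^ n)))"
    by (rule finite_subset [OF _ f(1)]) (use xG in auto)
  then have "\<not> inj (\<lambda>n::nat. f (x ^ n))"
    using finite_imageD infinite_UNIV_nat by blast
  then obtain i j :: nat where ij: "i < j" "f (x ^ i) = f (x ^ j)"
    unfolding inj_def by (metis linorder_neqE_nat)
  have "x ^ j * inverse (x ^ i) \<in> H"
    using f(2) [OF xG xG] ij(2) by simp
  moreover have "x ^ j = x ^ (j - i) * x ^ i"
    using ij(1) by (simp add: power_add [symmetric])
  ultimately have "x ^ (j - i) \<in> H"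
    using x0 by (simp add: mult.assoc)
  then show ?thesis
    using ij(1) by (intro exI [of _ "j - i"]) simp
qed

text \<open>Two of the elements \<open>a + t\<close> with central \<open>t\<close> lie in the same coset of \<open>H\<close>,
  so their quotient is central.\<close>

lemma central_if_index_center_finite:
  fixes a :: "'a::division_ring"
  assumes inf: "infinite (ring_center :: 'a set)" and D: "fin_index H (- {0 :: 'a})"
    and H: "H \<subseteq> ring_center"
  shows "a \<in> ring_center"
proof (rule ccontr)
  assume a: "a \<notin> ring_center"
  note FD = division_subringD [OF division_subring_center]
  obtain f :: "'a \<Rightarrow> 'a" where f: "finite (f ` (- {0}))"
      "\<And>x y. x \<in> - {0} \<Longrightarrow> y \<in> - {0} \<Longrightarrow> f x = f y \<Longrightarrow> x * inverse y \<in> H"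
    using D unfolding fin_index_def by blast
  have nz: "a + t \<noteq> 0" if "t \<in> ring_center" for t :: 'a
  proof
    assume "a + t = 0"
    then have "a = - t"
      by (simp add: add_eq_0_iff2)
    then show False
      using a FD(6) [OF that] by simp
  qed
  have "finite ((\<lambda>t. f (a + t)) ` ring_center)"
    by (rule finite_subset [OF _ f(1)]) (use nz in auto)
  then have "\<not> inj_on (\<lambda>t. f (a + t)) ring_center"
    using inf finite_imageD by blast
  then obtain s t where st: "s \<in> ring_center" "t \<in> ring_center" "s \<noteq> t" "f (a + s) = f (a + t)"
    unfolding inj_on_def by blast
  define z where "z = (a + s) * inverse (a + t)"
  have z: "z \<in> ring_center"
    using f(2) [of "a + s" "a + t"] nz st H by (auto simp: z_def)
  have eq: "a + s = z * (a + t)"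
    using nz [OF st(2)] by (simp add: z_def mult.assoc)
  have z1: "1 - z \<noteq> 0"
    using eq st(3) by auto
  have "(1 - z) * a = z * t - s"
    using eq by (simp add: algebra_simps)
  then have "inverse (1 - z) * ((1 - z) * a) \<in> ring_center"
    using z st by (auto intro: FD)
  moreover have "inverse (1 - z) * ((1 - z) * a) = a"
    using z1 by (simp add: mult.assoc [symmetric])
  ultimately show False
    using a by simp
qed

text \<open>At a normal step \<open>N \<subseteq> G\<close>, take a non-central \<open>a \<in> N\<close>. Some power \<open>a\<^sup>m\<close> is central, so the conjugates
  of \<open>a\<close> under \<open>G\<close> have the same \<open>m\<close>-th power, and two of them in one coset of \<open>H\<close> differ by an
  \<open>m\<close>-th root of unity in \<open>F\<close>. So \<open>a\<close> has finitely many conjugates under \<open>G\<close>, and its centralizer \<open>Z\<close> in \<open>G\<close>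
  has finite index. A subnormal subgroup of finite index in \<open>Z\<close> commutes with \<open>a\<close> and is therefore
  central; it has finite index in \<open>G\<close>, and the induction hypothesis makes \<open>G\<close> central.\<close>

lemma almost_sub_central:
  fixes N :: "'a::division_ring set"
  assumes inf: "infinite (ring_center :: 'a set)" and "almost_sub N"
    and "fin_index H N" "H \<subseteq> ring_center"
  shows "N \<subseteq> ring_center"
  using assms(2-)
proof (induction arbitrary: H rule: almost_sub.induct)
  case base
  then show ?case
    using central_if_index_center_finite [OF inf] by blast
next
  case (fin_index G N)
  have "fin_index H G"
    by (rule fin_index_trans [OF fin_index.prems(1) fin_index.hyps(4)
          almost_sub_mult_subgroup [OF fin_index.hyps(1)]])
  then show ?case
    using fin_index.IH fin_index.prems(2) fin_index.hyps(3) by blast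
next
  case (normal G N)
  show ?case
  proof (rule ccontr)
    assume "\<not> N \<subseteq> ring_center"
    then obtain a where a: "a \<in> N" "a \<notin> ring_center"
      by blast
    note Gsub = almost_sub_mult_subgroup [OF normal.hyps(1)]
    note GD = mult_subgroupD [OF Gsub] and ND = mult_subgroupD [OF normal.hyps(2)]
    have NG: "N \<subseteq> G" "\<And>g n. g \<in> G \<Longrightarrow> n \<in> N \<Longrightarrow> cj g n \<in> N"
      using normal.hyps by (auto simp: normal_in_def)
    obtain f :: "'a \<Rightarrow> 'a" where f: "finite (f ` N)"
        "\<And>x y. x \<in> N \<Longrightarrow> y \<in> N \<Longrightarrow> f x = f y \<Longrightarrow> x * inverse y \<in> H"
      using normal.prems(1) unfolding fin_index_def by blast
    obtain m where m: "m > 0" "a ^ m \<in> ring_center"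
      using fin_index_power [OF normal.prems(1) normal.hyps(2) a(1)] normal.prems(2) by blast
    define C where "C = (\<lambda>g. cj g a) ` G"
    have CN: "C \<subseteq> N"
      using NG(2) a(1) by (auto simp: C_def)
    have Cm: "y ^ m = a ^ m" if "y \<in> C" for y
    proof -
      obtain g where g: "g \<in> G" "y = cj g a"
        using \<open>y \<in> C\<close> by (auto simp: C_def)
      then have "y ^ m = cj g (a ^ m)"
        using GD(1) by (simp add: cj_power)
      also have "\<dots> = a ^ m"
        using GD(1) [OF g(1)] centerD [OF m(2), of g] by (simp add: cj_eq_iff)
      finally show ?thesis .
    qed
    define R where "R = {z \<in> ring_center. z ^ m = (1 :: 'a)}"
    define s where "s = (\<lambda>c. SOME y. y \<in> C \<and> f y = c)"
    have s: "s (f y) \<in> C \<and> f (s (f y)) = f y" if "y \<in> C" for y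
      unfolding s_def by (rule someI [of _ y]) (simp add: that)
    have "C \<subseteq> (\<lambda>(z, c). z * s c) ` (R \<times> f ` N)"
    proof
      fix y
      assume y: "y \<in> C"
      define u where "u = s (f y)"
      have u: "u \<in> C" "f y = f u" "u \<noteq> 0"
        using s [OF y] CN ND(1) by (auto simp: u_def)
      define z where "z = y * inverse u"
      have yz: "y = z * u"
        using u(3) by (simp add: z_def mult.assoc)
      have z: "z \<in> ring_center"
        using f(2) [of y u] CN y u normal.prems(2) by (auto simp: z_def)
      have "z ^ m * a ^ m = 1 * a ^ m"
        using center_mult_power [OF z, of u m] yz Cm [OF y] Cm [OF u(1)] by simp
      then have "z ^ m = 1"
        using ND(1) [OF a(1)] by simp
      then have "z \<in> R"
        using z by (simp add: R_def)
      then show "y \<in> (\<lambda>(z, c). z * s c) ` (R \<times> f ` N)"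
        using yz y CN unfolding u_def by (intro image_eqI [of _ _ "(z, f y)"]) auto
    qed
    then have finC: "finite C"
      using finite_roots_of_unity_center [OF inf m(1)] f(1) unfolding R_def
      by (meson finite_SigmaI finite_imageI finite_subset)
    define Z where "Z = {p \<in> G. p * a = a * p}"
    have Z: "mult_subgroup Z"
      unfolding mult_subgroup_def
    proof (intro conjI ballI)
      show "x * y \<in> Z" if "x \<in> Z" "y \<in> Z" for x y
        using that GD(3) unfolding Z_def by (auto simp: mult.assoc) (simp add: mult.assoc [symmetric])
      show "inverse x \<in> Z" if "x \<in> Z" for x
        using that GD(4) commute_inverse unfolding Z_def by blast
    qed (use GD(1,2) in \<open>auto simp: Z_def\<close>)
    have ZG: "fin_index Z G"
    proof (rule fin_indexI)
      have "(\<lambda>p. cj (inverse p) a) ` G \<subseteq> C"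
        using GD(4) unfolding C_def by blast
      then show "finite ((\<lambda>p. cj (inverse p) a) ` G)"
        using finC finite_subset by blast
      fix x y
      assume xy: "x \<in> G" "y \<in> G" "cj (inverse x) a = cj (inverse y) a"
      then have nz: "x \<noteq> 0" "y \<noteq> 0"
        using GD(1) by auto
      have "cj (x * inverse y) a = cj x (cj (inverse y) a)"
        using nz by (intro cj_mult_left) auto
      also have "\<dots> = a"
        unfolding xy(3) [symmetric] using nz by (intro cj_cj_inverse)
      finally have "x * inverse y * a = a * (x * inverse y)"
        using nz by (simp add: cj_eq_iff)
      then show "x * inverse y \<in> Z"
        using GD(3,4) xy by (auto simp: Z_def)
    qed
    have "almost_sub Z"
      by (rule almost_sub.fin_index [OF normal.hyps(1) Z _ ZG]) (auto simp: Z_def)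
    then obtain L r where L: "subnormal r L" "L \<subseteq> Z" "fin_index L Z"
      using almost_sub_subnormal by blast
    have "L \<subseteq> ring_center"
      by (rule subnormal_commuting_central [OF inf L(1) a(2)]) (use L(2) in \<open>auto simp: Z_def\<close>)
    moreover have "fin_index L G"
      by (rule fin_index_trans [OF L(3) ZG Gsub])
    ultimately have "G \<subseteq> ring_center"
      using normal.IH by blast
    then show False
      using a NG(1) by blast
  qed
qed

section \<open>Subnormality in the multiplicative group\<close>

lemma inv_mult_group_carrier:
  assumes "group (mult_group\<lparr>carrier := S\<rparr>)" "x \<in> S" "inverse x \<in> S" "x \<noteq> (0::'a::division_ring)"
  shows "inv\<^bsub>mult_group\<lparr>carrier := S\<rparr>\<^esub> x = inverse x"
  by (rule group.inv_equality [OF assms(1)]) (use assms in \<open>simp_all add: mult_group_def\<close>)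

lemma subgroup_mult_group:
  fixes H :: "'a::division_ring set"
  assumes "subgroup H mult_group"
  shows "mult_subgroup H"
proof -
  interpret subgroup H "mult_group :: 'a monoid"
    by (rule assms)
  have H0: "x \<noteq> 0" if "x \<in> H" for x
    using subset that by (auto simp: mult_group_def)
  have inv: "inv\<^bsub>mult_group\<^esub> x = inverse x" if "x \<in> H" for x
    by (rule group.inv_equality [OF group_mult_group]) (use H0 [OF that] in \<open>simp_all add: mult_group_def\<close>)
  have "inverse x \<in> H" if "x \<in> H" for x
    using m_inv_closed [OF that] inv [OF that] by simp
  then show ?thesis
    using H0 m_closed one_closed by (auto simp: mult_subgroup_def mult_group_def)
qed

lemma normal_mult_group:
  fixes H S :: "'a::division_ring set"
  assumes "H \<lhd> mult_group\<lparr>carrier := S\<rparr>" "mult_subgroup S" "H \<subseteq> S"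
  shows "normal_in H S"
proof -
  note SD = mult_subgroupD [OF assms(2)]
  have "group (mult_group\<lparr>carrier := S\<rparr>)"
    using assms(1) by (simp add: normal_def)
  then have inv: "inv\<^bsub>mult_group\<lparr>carrier := S\<rparr>\<^esub> g = inverse g" if "g \<in> S" for g
    using that SD by (intro inv_mult_group_carrier) auto
  have "cj g h \<in> H" if "g \<in> S" "h \<in> H" for g h
    using normal.inv_op_closed2 [OF assms(1), of g h] that inv [OF that(1)]
    by (simp add: mult_group_def cj_def)
  then show ?thesis
    using assms(3) by (simp add: normal_in_def)
qed

lemma finite_index_mult_group:
  fixes H S :: "'a::division_ring set"
  assumes "finite_index H (mult_group\<lparr>carrier := S\<rparr>)" "mult_subgroup H" "mult_subgroup S"
  shows "fin_index H S"
proof (rule fin_indexI)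
  let ?c = "\<lambda>x. H #>\<^bsub>mult_group\<lparr>carrier := S\<rparr>\<^esub> x"
  have "?c ` S = rcosets\<^bsub>mult_group\<lparr>carrier := S\<rparr>\<^esub> H"
    by (auto simp: RCOSETS_def)
  then show "finite (?c ` S)"
    using assms(1) by (simp add: finite_index_def)
  fix x y
  assume xy: "x \<in> S" "y \<in> S" "?c x = ?c y"
  have "x \<in> ?c x"
    using mult_subgroupD(2) [OF assms(2)] by (force simp: r_coset_def mult_group_def)
  then have "x \<in> ?c y"
    unfolding xy(3) .
  then obtain h where "h \<in> H" "x = h * y"
    by (auto simp: r_coset_def mult_group_def)
  then show "x * inverse y \<in> H"
    using mult_subgroupD(1) [OF assms(3) xy(2)] by (simp add: mult.assoc)
qed

lemma almost_subnormal_almost_sub: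
  fixes N :: "'a::division_ring set"
  assumes "almost_subnormal N mult_group"
  shows "almost_sub N"
proof -
  obtain r S where S: "S 0 = carrier mult_group" "S r = N" "\<And>i. i \<le> r \<Longrightarrow> subgroup (S i) mult_group"
    "\<And>i. i < r \<Longrightarrow> S (Suc i) \<subseteq> S i \<and> (S (Suc i) \<lhd> mult_group\<lparr>carrier := S i\<rparr> \<or>
        finite_index (S (Suc i)) (mult_group\<lparr>carrier := S i\<rparr>))"
    using assms unfolding almost_subnormal_def by blast
  have "almost_sub (S i)" if "i \<le> r" for i
    using that
  proof (induction i)
    case 0
    have "S 0 = - {0}"
      using S(1) by (auto simp: mult_group_def)
    then show ?case
      using almost_sub.base by simp
  next
    case (Suc i)
    then have i: "i < r" "almost_sub (S i)"
      by simp_all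
    have sub: "mult_subgroup (S i)" "mult_subgroup (S (Suc i))"
      using S(3) Suc.prems by (auto intro: subgroup_mult_group)
    have incl: "S (Suc i) \<subseteq> S i"
      using S(4) [OF i(1)] by blast
    consider "S (Suc i) \<lhd> mult_group\<lparr>carrier := S i\<rparr>"
      | "finite_index (S (Suc i)) (mult_group\<lparr>carrier := S i\<rparr>)"
      using S(4) [OF i(1)] by blast
    then show ?case
    proof cases
      case 1
      then show ?thesis
        by (intro almost_sub.normal [OF i(2) sub(2)] normal_mult_group sub incl)
    next
      case 2
      then show ?thesis
        by (intro almost_sub.fin_index [OF i(2) sub(2) incl] finite_index_mult_group sub)
    qed
  qed
  then show ?thesis
    using S(2) by blast
qed

theorem theorem3p10:
  fixes K N :: "'a::division_ring set"
  assumes "infinite (ring_center :: 'a set)"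
    and "division_subring K"
    and "subgroup N mult_group"
    and "almost_subnormal N mult_group"
    and "\<not> N \<subseteq> ring_center"
    and "invariant_under N K"
  shows "K \<subseteq> ring_center \<or> K = UNIV"
proof -
  have N: "almost_sub N"
    using assms(4) by (rule almost_subnormal_almost_sub)
  obtain H r where H: "subnormal r H" "H \<subseteq> N" "fin_index H N"
    using almost_sub_subnormal [OF N] by blast
  have "\<not> H \<subseteq> ring_center"
    using almost_sub_central [OF assms(1) N H(3)] assms(5) by blast
  moreover have "cj g k \<in> K" if "g \<in> H" "k \<in> K" for g k
    using assms(6) H(2) that unfolding invariant_under_def cj_def by blast
  ultimately show ?thesis
    by (intro subnormal_invariant_division_subring [OF assms(1,2) H(1)])
qed

end
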